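(* Let $G$ be a non-trivial finite abelian group with invariant-factor decomposition $$G\cong C_{m_1}\oplus\cdots\oplus C_{m_t},\qquad 1<m_1\mid\cdots\mid m_t,$$ and put $$P=\sum_{i=1}^t(m_i-1),\qquad Q=\sum_{i=1}^t\left\lfloor\frac{m_i}{2}\right\rfloor,\qquad e=m_t.$$ Then $$\bigl(r_{\mathcal I}(\mathcal A_G),r_{\mathcal D}(\mathcal A_G)\bigr)=\left(\left\lceil\log_2(P+1)\right\rceil,\ 1+\left\lceil\log_2\max\{e-1,Q\}\right\rceil\right).$$ For the trivial group $G$, $\bigl(r_{\mathcal I}(\mathcal A_G),r_{\mathcal D}(\mathcal A_G)\bigr)=(0,1)$.
   Context: $C_m$ is the cyclic group of order $m$. For a finite group $G$, $\mathcal A_G$ is the variety of left $G$-sets with a named constant $c$: its signature has unary operations $\lambda_g$ ($g\in G$) and a constant $c$, with identities $\lambda_1(x)=x$ (here $1$ is the identity of $G$) and $\lambda_g(\lambda_h(x))=\lambda_{gh}(x)$; no identity involving $c$ is imposed. A semicongruence on an algebra $A$ is a reflexive binary relation on $A$ which is a subalgebra of $A\times A$. For $A\in\mathcal A_G$ and $I\subseteq A$, let $R_I$ be the least semicongruence containing $I\times\{c\}$, and put $$\mathcal I_c(I)=\{x\in A\mid x\,R_I\,y\text{ for some }y\in I\},\qquad \mathcal D_c(I)=\{x\in A\mid y\,R_I\,x\text{ for some }y\in I\}.$$ Write $\mathcal I_c^n,\mathcal D_c^n$ for the $n$-fold iterates (the relation being regenerated from the current set at every step), with the zeroth iterate the identity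 operator. The inductive rank $r_{\mathcal I}(\mathcal A_G)$, taken at $c$, is the least integer $n\ge 0$ such that $\mathcal I_c^n(I)=\mathcal I_c^{n+1}(I)$ for every non-empty subset $I$ of every $A\in\mathcal A_G$ (and $\infty$ if there is none); the deductive rank $r_{\mathcal D}(\mathcal A_G)$ is defined in the same way with $\mathcal D_c$. *)

theory Defs
  imports Complex_Main "HOL-Algebra.Product_Groups" "HOL-Library.Extended_Nat"
begin

text \<open>
  Algebras in the signature with unary operations \<open>act A g\<close> and a constant \<open>pt A\<close>. Only the
  restriction of \<open>act A\<close> to group elements and points of the carrier is meaningful.
\<close>

record ('a, 'g) pointed_gset = "'a partial_object" +
  act :: "'g \<Rightarrow> 'a \<Rightarrow> 'a"
  pt :: 'a

definition pointed_gsets :: "('g, 'b) monoid_scheme \<Rightarrow> ('a, 'g) pointed_gset set" where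
  "pointed_gsets G = {A.
     pt A \<in> carrier A \<and>
     (\<forall>g\<in>carrier G. \<forall>x\<in>carrier A. act A g x \<in> carrier A) \<and>
     (\<forall>x\<in>carrier A. act A \<one>\<^bsub>G\<^esub> x = x) \<and>
     (\<forall>g\<in>carrier G. \<forall>h\<in>carrier G. \<forall>x\<in>carrier A.
        act A g (act A h x) = act A (g \<otimes>\<^bsub>G\<^esub> h) x)}"

definition square_alg :: "('a, 'g) pointed_gset \<Rightarrow> ('a \<times> 'a, 'g) pointed_gset" where
  "square_alg A = \<lparr>carrier = carrier A \<times> carrier A,
     act = (\<lambda>g (x, y). (act A g x, act A g y)), pt = (pt A, pt A)\<rparr>"

definition subalgebra ::
  "('g, 'b) monoid_scheme \<Rightarrow> 'a set \<Rightarrow> ('a, 'g) pointed_gset \<Rightarrow> bool" where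
  "subalgebra G S A \<longleftrightarrow>
     S \<subseteq> carrier A \<and> pt A \<in> S \<and> (\<forall>g\<in>carrier G. \<forall>x\<in>S. act A g x \<in> S)"

definition semicongruence ::
  "('g, 'b) monoid_scheme \<Rightarrow> ('a, 'g) pointed_gset \<Rightarrow> 'a rel \<Rightarrow> bool" where
  "semicongruence G A R \<longleftrightarrow> refl_on (carrier A) R \<and> subalgebra G R (square_alg A)"

definition gen_semicong ::
  "('g, 'b) monoid_scheme \<Rightarrow> ('a, 'g) pointed_gset \<Rightarrow> 'a set \<Rightarrow> 'a rel" where
  "gen_semicong G A I = \<Inter>{R. semicongruence G A R \<and> I \<times> {pt A} \<subseteq> R}"

lemma gen_semicong_least:
  assumes "A \<in> pointed_gsets G" "I \<subseteq> carrier A"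
  shows "semicongruence G A (gen_semicong G A I)"
    and "I \<times> {pt A} \<subseteq> gen_semicong G A I"
    and "\<lbrakk>semicongruence G A R; I \<times> {pt A} \<subseteq> R\<rbrakk> \<Longrightarrow> gen_semicong G A I \<subseteq> R"
proof -
  have "semicongruence G A (carrier A \<times> carrier A)" "I \<times> {pt A} \<subseteq> carrier A \<times> carrier A"
    using assms
    by (auto simp: semicongruence_def subalgebra_def square_alg_def pointed_gsets_def refl_on_def)
  then have "gen_semicong G A I \<subseteq> carrier A \<times> carrier A"
    unfolding gen_semicong_def by blast
  then show "semicongruence G A (gen_semicong G A I)"
    by (auto simp: gen_semicong_def semicongruence_def subalgebra_def square_alg_def refl_on_def)
  show "I \<times> {pt A} \<subseteq> gen_semicong G A I"
    by (auto simp: gen_semicong_def)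
  show "gen_semicong G A I \<subseteq> R" if "semicongruence G A R" "I \<times> {pt A} \<subseteq> R"
    using that by (auto simp: gen_semicong_def)
qed

definition ind_op ::
  "('g, 'b) monoid_scheme \<Rightarrow> ('a, 'g) pointed_gset \<Rightarrow> 'a set \<Rightarrow> 'a set" where
  "ind_op G A I = {x \<in> carrier A. \<exists>y\<in>I. (x, y) \<in> gen_semicong G A I}"

definition ded_op ::
  "('g, 'b) monoid_scheme \<Rightarrow> ('a, 'g) pointed_gset \<Rightarrow> 'a set \<Rightarrow> 'a set" where
  "ded_op G A I = {x \<in> carrier A. \<exists>y\<in>I. (y, x) \<in> gen_semicong G A I}"

text \<open>
  HOL cannot quantify over all algebras of the variety inside a term, so the ranks take a type
  \<open>'a\<close> and range over the algebras carried by subsets of \<open>'a\<close>. Every algebra is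
  isomorphic to one carried by a subset of some infinite type. The infimum in \<^typ>\<open>enat\<close> is
  the least such natural number, and \<open>\<infinity>\<close> if there is none.
\<close>

definition inductive_rank :: "'a itself \<Rightarrow> ('g, 'b) monoid_scheme \<Rightarrow> enat" where
  "inductive_rank (_ :: 'a itself) G = Inf {enat n |n.
     \<forall>A \<in> (pointed_gsets G :: ('a, 'g) pointed_gset set). \<forall>I. I \<subseteq> carrier A \<and> I \<noteq> {} \<longrightarrow>
       (ind_op G A ^^ n) I = (ind_op G A ^^ (n + 1)) I}"

definition deductive_rank :: "'a itself \<Rightarrow> ('g, 'b) monoid_scheme \<Rightarrow> enat" where
  "deductive_rank (_ :: 'a itself) G = Inf {enat n |n.
     \<forall>A \<in> (pointed_gsets G :: ('a, 'g) pointed_gset set). \<forall>I. I \<subseteq> carrier A \<and> I \<noteq> {} \<longrightarrow>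
       (ded_op G A ^^ n) I = (ded_op G A ^^ (n + 1)) I}"

end

theory Submission
  imports Defs "HOL-Algebra.Multiplicative_Group"
begin

text \<open>
  The semicongruence generated by \<open>I \<times> {c}\<close> consists of the diagonal and the pairs
  \<open>(g i, g c)\<close> with \<open>i \<in> I\<close>, so both operators are governed by
  \<open>S = {g. g c \<in> I}\<close>. Write \<open>I\<^sub>n\<close> for the iterates and \<open>S\<^sub>n = {g. g c \<in> I\<^sub>n}\<close>.

  For the inductive operator, \<open>I\<^sub>n\<^sub>+\<^sub>1 = I\<^sub>n \<union> S\<^sub>n I\<^sub>n\<close>. With \<open>T = S \<union> {1}\<close> this gives
  \<open>I\<^sub>n = T^(2^n - 1) I\<close>: the iteration is stationary once \<open>2^n - 1\<close> factors from \<open>T\<close> reach the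
  whole subgroup generated by \<open>T\<close>. For the deductive operator let \<open>V = {g. \<exists>i\<in>I. g i \<in> I}\<close>, a
  symmetric set containing all quotients of elements of \<open>S\<close>. One step gives \<open>S\<^sub>1 \<supseteq> S \<union> V\<close>, and
  then \<open>S\<^sub>n\<^sub>+\<^sub>1 \<supseteq> S\<^sub>n S\<^sub>n\<inverse>\<close>, so that \<open>S\<^sub>n\<close> contains all products of \<open>2^(n - 2)\<close> elements of \<open>S\<^sub>1\<close>
  and \<open>2^(n - 2)\<close> inverses of such elements. As \<open>S \<subseteq> V s\<close> for any \<open>s \<in> S\<close>, the question is how
  cheaply an element of the subgroup generated by \<open>V\<close> and \<open>s\<close> can be written with letters from
  \<open>V\<close> and at most \<open>2^(n - 2)\<close> letters \<open>s\<close>, or as many inverses of \<open>s\<close>.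

  Upper bounds. Adjoin the letters one after the other to the trivial subgroup and let
  \<open>k\<^sub>1, k\<^sub>2, \<dots>\<close> be the successive indices. Every element is a product of powers of the letters with
  the exponent of the \<open>j\<close>-th letter in a prescribed window of \<open>k\<^sub>j\<close> consecutive integers, at a cost
  of at most \<open>k\<^sub>j - 1\<close> (nonnegative exponents) or \<open>k\<^sub>j div 2\<close> (centred exponents). So it suffices
  that \<open>\<Sum>g(k\<^sub>j) \<le> \<Sum>g(m\<^sub>i)\<close> for \<open>g(x) = x - 1\<close> and \<open>g(x) = x div 2\<close>. The group enters only through
  one fact: a subgroup generated by \<open>j\<close> elements has order dividing the product of the \<open>j\<close>
  largest invariant factors (\<open>growth_bound_trivial\<close>). Adjoining a letter of relative order \<open>x\<close>
  transforms the profile of invariant factors \<open>y\<close> into \<open>deflate y x\<close>, which bounds the growth over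
  the larger subgroup (\<open>growth_bound_adjoin\<close>), and \<open>\<Sum>g(y)\<close> drops by at least \<open>g(x)\<close>
  (\<open>sum_deflate\<close>), because both \<open>g\<close> satisfy \<open>g(b u) + g(b w) \<le> g(b u w) + g(b)\<close>. Any order of the
  letters will do; in the deductive case \<open>s\<close> comes last, so its exponent has absolute value at most
  half of the exponent \<open>e\<close> of the group (\<open>generate_words\<close>, \<open>generate_symmetric_words\<close>).

  Lower bounds come from finite free pointed \<open>G\<close>-sets. Let the \<open>e\<^sub>i\<close> be the standard generators.
  If \<open>S = {1, e\<^sub>1, \<dots>, e\<^sub>t}\<close> and \<open>I\<close> contains one point of a second free orbit, the word length in
  the \<open>e\<^sub>i\<close> bounds what \<open>n\<close> inductive steps reach, and the element with all coordinates
  \<open>m\<^sub>i - 1\<close> has length \<open>P\<close>. If \<open>S\<close> is empty and \<open>I\<close> contains pairs \<open>{x, e\<^sub>i x}\<close> in separate free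
  orbits, then \<open>S\<^sub>1\<close> consists of \<open>1\<close> and the \<open>e\<^sub>i\<close> and their inverses, and the symmetric word length
  of the element with coordinates \<open>m\<^sub>i div 2\<close> is \<open>Q\<close>. If \<open>I = {a c}\<close> with \<open>a\<close> of order \<open>e\<close>, then
  \<open>S\<^sub>n\<close> consists of powers of \<open>a\<close> with exponents in an interval of length \<open>2^(n - 1)\<close> for \<open>n \<ge> 1\<close>.
\<close>

section \<open>Adjoining one element to a subgroup\<close>

definition rel_order :: "('g, 'b) monoid_scheme \<Rightarrow> 'g set \<Rightarrow> 'g \<Rightarrow> nat" where
  "rel_order G K a = (LEAST r. 0 < r \<and> a [^]\<^bsub>G\<^esub> r \<in> K)"

locale finite_comm_group = comm_group G for G (structure) +
  assumes finite_carrier: "finite (carrier G)"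
begin

lemma finite_subgroup: "subgroup K G \<Longrightarrow> finite K"
  using finite_carrier finite_subset subgroup.subset by blast

lemma rel_order:
  assumes "subgroup K G" "a \<in> carrier G"
  shows "0 < rel_order G K a" "a [^] rel_order G K a \<in> K"
proof -
  have "0 < order G \<and> a [^] order G \<in> K"
    using assms finite_carrier
    by (simp add: order_gt_0_iff_finite pow_order_eq_1 subgroup.one_closed)
  from LeastI[of "\<lambda>r. 0 < r \<and> a [^] r \<in> K", OF this]
  show "0 < rel_order G K a" "a [^] rel_order G K a \<in> K"
    unfolding rel_order_def by blast+
qed

text \<open>
  The exponents that take \<open>a\<close> into \<open>K\<close> form a subgroup of the integers, and the relative order is
  its positive generator.
\<close>

lemma int_pow_mem_iff:
  fixes i :: int
  assumes K: "subgroup K G" and a: "a \<in> carrier G"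
  shows "a [^] i \<in> K \<longleftrightarrow> int (rel_order G K a) dvd i"
proof -
  define x where "x = rel_order G K a"
  have x: "0 < x" "a [^] int x \<in> K"
    using rel_order[OF K a] by (simp_all add: x_def int_pow_int)
  have mult: "a [^] (int x * q) \<in> K" for q
    using subgroup_int_pow_closed[OF K x(2), of q] a by (simp add: int_pow_pow)
  show ?thesis
  proof
    assume "a [^] i \<in> K"
    have "a [^] (i mod int x) = a [^] i \<otimes> inv (a [^] (int x * (i div int x)))"
      using int_pow_diff[OF a, of i "int x * (i div int x)"] by (simp add: minus_mult_div_eq_mod)
    also have "\<dots> \<in> K"
      using \<open>a [^] i \<in> K\<close> mult K by (simp add: subgroup.m_closed subgroup.m_inv_closed)
    finally have "a [^] nat (i mod int x) \<in> K"
      using x(1) by (simp flip: int_pow_int)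
    moreover have "nat (i mod int x) < x"
      using x(1) by (simp add: nat_less_iff)
    ultimately have "nat (i mod int x) = 0"
      using not_less_Least[of "nat (i mod int x)" "\<lambda>r. 0 < r \<and> a [^] r \<in> K"]
      by (auto simp: x_def rel_order_def)
    then show "int (rel_order G K a) dvd i"
      using x(1) unfolding x_def[symmetric]
      by (metis mod_0_imp_dvd nat_0_iff order_antisym pos_mod_sign of_nat_0_less_iff)
  next
    assume "int (rel_order G K a) dvd i"
    then show "a [^] i \<in> K"
      using mult by (auto simp: x_def dvd_def)
  qed
qed

lemma rel_order_dvd:
  assumes "subgroup K G" "a \<in> carrier G" "a [^] (r::nat) \<in> K"
  shows "rel_order G K a dvd r"
  using int_pow_mem_iff[OF assms(1,2), of "int r"] assms(3) by (simp add: int_pow_int)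

lemma subgroup_adjoin:
  "subgroup K G \<Longrightarrow> a \<in> carrier G \<Longrightarrow> subgroup (generate G (insert a K)) G"
  by (simp add: generate_is_subgroup subgroup.subset)

lemma adjoin_mem:
  assumes K: "subgroup K G" and a: "a \<in> carrier G" and h: "h \<in> generate G (insert a K)"
  shows "\<exists>k\<in>K. \<exists>i::int. h = k \<otimes> a [^] i"
  using h
proof induction
  case one
  show ?case
    by (intro bexI[of _ \<one>] exI[of _ 0]) (simp_all add: K subgroup.one_closed)
next
  case (incl h)
  show ?case
  proof (cases "h = a")
    case True
    then show ?thesis
      by (intro bexI[of _ \<one>] exI[of _ 1]) (simp_all add: K a subgroup.one_closed)
  next
    case False
    then show ?thesis
      using incl K by (intro bexI[of _ h] exI[of _ 0]) (auto simp: subgroup.mem_carrier)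
  qed
next
  case (inv h)
  show ?case
  proof (cases "h = a")
    case True
    then show ?thesis
      by (intro bexI[of _ \<one>] exI[of _ "-1"])
        (simp_all add: K a subgroup.one_closed int_pow_neg)
  next
    case False
    then show ?thesis
      using inv K
      by (intro bexI[of _ "inv h"] exI[of _ 0]) (auto simp: subgroup.mem_carrier subgroup.m_inv_closed)
  qed
next
  case (eng h1 h2)
  then obtain k1 i1 k2 i2 where eq: "k1 \<in> K" "k2 \<in> K"
      "h1 = k1 \<otimes> a [^] (i1::int)" "h2 = k2 \<otimes> a [^] (i2::int)"
    by blast
  have "k1 \<in> carrier G" "k2 \<in> carrier G"
    using eq K by (auto simp: subgroup.mem_carrier)
  then have "h1 \<otimes> h2 = (k1 \<otimes> k2) \<otimes> a [^] (i1 + i2)"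
    using a eq by (simp add: int_pow_mult m_ac)
  then show ?case
    using eq K by (meson subgroup.m_closed)
qed

text \<open>
  Exponents matter only modulo the relative order, up to a factor in \<open>K\<close>, so any window of that
  many consecutive integers will do. The freedom in \<open>lo\<close> is what separates nonnegative exponents
  (cost at most \<open>x - 1\<close>) from centred ones (cost at most \<open>x div 2\<close>).
\<close>

lemma adjoin_mem_window:
  fixes lo :: int
  assumes K: "subgroup K G" and a: "a \<in> carrier G" and h: "h \<in> generate G (insert a K)"
  obtains k i where "k \<in> K" "lo \<le> i" "i < lo + int (rel_order G K a)" "h = k \<otimes> a [^] i"
proof -
  define x where "x = int (rel_order G K a)"
  have x: "0 < x"
    using rel_order[OF K a] by (simp add: x_def)
  obtain k i where k: "k \<in> K" "h = k \<otimes> a [^] (i::int)"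
    using adjoin_mem[OF K a h] by blast
  define i' where "i' = lo + (i - lo) mod x"
  have "x dvd i - i'"
    unfolding i'_def by (metis diff_diff_add dvd_minus_mod)
  then have mem: "a [^] (i - i') \<in> K"
    using int_pow_mem_iff[OF K a] by (simp add: x_def)
  have "h = (k \<otimes> a [^] (i - i')) \<otimes> a [^] i'"
    using k K a int_pow_mult[OF a, of "i - i'" i'] by (simp add: m_assoc subgroup.mem_carrier)
  moreover have "lo \<le> i'" "i' < lo + x"
    using x by (simp_all add: i'_def)
  ultimately show thesis
    using that[of "k \<otimes> a [^] (i - i')" i'] k mem K by (simp add: subgroup.m_closed x_def)
qed

lemma card_adjoin:
  assumes K: "subgroup K G" and a: "a \<in> carrier G"
  shows "card (generate G (insert a K)) = rel_order G K a * card K"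
proof -
  define x where "x = rel_order G K a"
  define f where "f = (\<lambda>(k, i). k \<otimes> a [^] (i::int))"
  have KG: "K \<subseteq> carrier G"
    using K by (rule subgroup.subset)
  have "inj_on f (K \<times> {0..<int x})"
  proof (rule inj_onI, clarify)
    fix k i l j
    assume kl: "k \<in> K" "l \<in> K" and ij: "i \<in> {0..<int x}" "j \<in> {0..<int x}"
      and "f (k, i) = f (l, j)"
    then have eq: "k \<otimes> a [^] i = l \<otimes> a [^] j"
      by (simp add: f_def)
    have c: "k \<in> carrier G" "l \<in> carrier G"
      using kl KG by auto
    have "inv k \<otimes> l = inv k \<otimes> (l \<otimes> a [^] j) \<otimes> inv (a [^] j)"
      using c a by (simp add: m_assoc)
    also have "\<dots> = inv k \<otimes> (k \<otimes> a [^] i) \<otimes> inv (a [^] j)"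
      by (simp only: eq)
    also have "\<dots> = a [^] (i - j)"
      using c a by (simp add: int_pow_diff flip: m_assoc)
    finally have "a [^] (i - j) = inv k \<otimes> l" ..
    then have "a [^] (i - j) \<in> K"
      using kl K by (simp add: subgroup.m_closed subgroup.m_inv_closed)
    then have "int x dvd i - j"
      using int_pow_mem_iff[OF K a] by (simp add: x_def)
    then have "i = j"
      using ij by (auto dest: zdvd_imp_le simp: zdvd_not_zless mod_eq_dvd_iff[symmetric])
    then show "k = l \<and> i = j"
      using eq c a by simp
  qed
  moreover have "f ` (K \<times> {0..<int x}) = generate G (insert a K)"
  proof
    show "f ` (K \<times> {0..<int x}) \<subseteq> generate G (insert a K)"
      using subgroup_int_pow_closed[OF subgroup_adjoin[OF K a], of a]
      by (auto simp: f_def intro!: generate.eng intro: generate.incl)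
    show "generate G (insert a K) \<subseteq> f ` (K \<times> {0..<int x})"
    proof
      fix h assume "h \<in> generate G (insert a K)"
      from adjoin_mem_window[OF K a this, of 0] obtain k i
        where "k \<in> K" "0 \<le> i" "i < int x" "h = k \<otimes> a [^] i"
        by (auto simp: x_def)
      then show "h \<in> f ` (K \<times> {0..<int x})"
        by (force simp: f_def)
    qed
  qed
  ultimately have "card (generate G (insert a K)) = card (K \<times> {0..<int x})"
    by (metis card_image)
  then show ?thesis
    by (simp add: card_cartesian_product x_def)
qed

lemma generate_absorb:
  assumes "B \<subseteq> carrier G" "C \<subseteq> carrier G"
  shows "generate G (generate G B \<union> C) = generate G (B \<union> C)"
proof
  have "subgroup (generate G (B \<union> C)) G"
    using assms by (simp add: generate_is_subgroup)
  moreover have "generate G B \<union> C \<subseteq> generate G (B \<union> C)"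
    using mono_generate[of B "B \<union> C"] by (auto intro: generate.incl)
  ultimately show "generate G (generate G B \<union> C) \<subseteq> generate G (B \<union> C)"
    by (rule generate_subgroup_incl[rotated])
  show "generate G (B \<union> C) \<subseteq> generate G (generate G B \<union> C)"
    by (rule mono_generate) (auto intro: generate.incl)
qed

lemma generate_subgroup_self: "subgroup K G \<Longrightarrow> generate G K = K"
  by (meson generate_subgroup_incl generate.incl subset_antisym subsetI subset_refl)

text \<open>
  Adjoining the elements one by one, the order grows at each step by a relative order, and this
  divides \<open>r i\<close>.
\<close>

lemma card_generate_union_dvd:
  assumes "finite I" "b ` I \<subseteq> carrier G" "subgroup K G" "\<And>i. i \<in> I \<Longrightarrow> b i [^] (r i :: nat) \<in> K"
  shows "card (generate G (K \<union> b ` I)) dvd card K * (\<Prod>i\<in>I. r i)"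
  using assms
proof induction
  case empty
  then show ?case by (simp add: generate_subgroup_self)
next
  case (insert i I)
  define L where "L = generate G (K \<union> b ` I)"
  have KG: "K \<subseteq> carrier G" and bG: "b i \<in> carrier G"
    using insert by (auto simp: subgroup.subset)
  have L: "subgroup L G"
    unfolding L_def using insert KG by (intro generate_is_subgroup) auto
  have "generate G (K \<union> b ` insert i I) = generate G (insert (b i) L)"
    using generate_absorb[of "K \<union> b ` I" "{b i}"] insert.prems KG by (simp add: L_def Un_commute)
  then have "card (generate G (K \<union> b ` insert i I)) = rel_order G L (b i) * card L"
    using card_adjoin[OF L bG] by simp
  moreover have "b i [^] r i \<in> L"
    using insert.prems(3) by (auto simp: L_def intro: generate.incl)
  then have "rel_order G L (b i) dvd r i"
    using rel_order_dvd[OF L bG] by blast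
  moreover have "card L dvd card K * prod r I"
    unfolding L_def using insert by auto
  ultimately have "card (generate G (K \<union> b ` insert i I)) dvd r i * (card K * prod r I)"
    by (metis mult_dvd_mono)
  then show ?case
    using insert.hyps by (simp add: mult.left_commute)
qed

lemma card_subgroup_dvd:
  assumes "subgroup A G" "subgroup C G" "A \<subseteq> C"
  shows "card A dvd card C"
proof -
  interpret C: group "G\<lparr>carrier := C\<rparr>"
    by (rule subgroup_imp_group[OF assms(2)])
  have "order (G\<lparr>carrier := C\<rparr>) = card C"
    by (simp add: order_def)
  then show ?thesis
    using C.lagrange[OF subgroup_incl[OF assms]] by (metis dvd_triv_right)
qed

end

section \<open>Deflation of divisor chains\<close>

text \<open>
  For every prime \<open>p\<close>, let the \<open>p\<close>-adic valuations of a decreasing divisor chain \<open>y\<close> be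
  \<open>a\<^sub>0 \<ge> a\<^sub>1 \<ge> \<dots>\<close> and let the valuation \<open>\<xi>\<close> of a divisor \<open>x\<close> of \<open>y 0\<close> lie between \<open>a\<^sub>j\<close> and \<open>a\<^sub>j\<^sub>+\<^sub>1\<close>. Then
  \<open>deflate y x\<close> has the valuations of \<open>y\<close> with the two entries \<open>a\<^sub>j, a\<^sub>j\<^sub>+\<^sub>1\<close> merged into the single
  entry \<open>a\<^sub>j + a\<^sub>j\<^sub>+\<^sub>1 - \<xi>\<close>: the total valuation drops by \<open>\<xi>\<close>. The position \<open>j\<close> may depend on \<open>p\<close>;
  the formula handles all primes at once.
\<close>

definition deflate :: "(nat \<Rightarrow> nat) \<Rightarrow> nat \<Rightarrow> nat \<Rightarrow> nat" where
  "deflate y x i = y i div gcd (y i) x * gcd (y (Suc i)) x"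

lemma deflate_pos:
  assumes "\<And>i. 0 < y i"
  shows "0 < deflate y x i"
  using assms[of i] assms[of "Suc i"] gcd_le1_nat[of "y i" x]
  by (simp add: deflate_def div_greater_zero_iff)

lemma deflate_mult_gcd: "deflate y x i * gcd (y i) x = y i * gcd (y (Suc i)) x"
  unfolding deflate_def by (metis dvd_div_mult_self gcd_dvd1 mult.assoc mult.commute)

lemma deflate_dvd:
  assumes "\<And>i. y (Suc i) dvd y i" "0 < x"
  shows "deflate y x (Suc i) dvd deflate y x i"
proof -
  \<comment> \<open>Multiplied by \<open>x\<close>, an entry is a product of two expressions that are monotone for divisibility.\<close>
  have lcm: "deflate y x i * x = lcm (y i) x * gcd (y (Suc i)) x" for i
    using dvd_div_mult[of "gcd (y i) x" "y i" x]
    unfolding deflate_def lcm_nat_def by (simp add: mult_ac)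
  have "lcm (y (Suc i)) x * gcd (y (Suc (Suc i))) x dvd lcm (y i) x * gcd (y (Suc i)) x"
    using assms by (intro mult_dvd_mono lcm_mono gcd_mono) auto
  then show ?thesis
    using assms(2) by (simp flip: lcm)
qed

lemma prod_deflate:
  "(\<Prod>i<j. deflate y x i) * gcd (y 0) x = (\<Prod>i<j. y i) * gcd (y j) x"
proof (induction j)
  case (Suc j)
  have "(\<Prod>i<Suc j. deflate y x i) * gcd (y 0) x
      = ((\<Prod>i<j. deflate y x i) * gcd (y 0) x) * deflate y x j"
    by simp
  also have "\<dots> = (\<Prod>i<j. y i) * gcd (y j) x * deflate y x j"
    by (simp only: Suc)
  also have "\<dots> = (\<Prod>i<j. y i) * (y j * gcd (y (Suc j)) x)"
    by (simp only: deflate_mult_gcd[symmetric] mult_ac)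
  finally show ?case
    by (simp add: mult_ac)
qed simp

text \<open>
  The cost functions of the argument satisfy a supermodular inequality with respect to
  divisibility: passing from the pair \<open>(b u, b w)\<close> to the more unequal pair \<open>(b u w, b)\<close> with the
  same product does not lower the total cost.
\<close>

definition mult_supermodular :: "(nat \<Rightarrow> nat) \<Rightarrow> bool" where
  "mult_supermodular g \<longleftrightarrow> g 1 = 0 \<and> (\<forall>b u w. 0 < b \<and> 0 < u \<and> 0 < w \<longrightarrow> g (b * u) + g (b * w) \<le> g (b * u * w) + g b)"

lemma four_point_identity:
  fixes b u w :: nat
  assumes "0 < u" "0 < w"
  shows "b * u + b * w + b * ((u - 1) * (w - 1)) = b * u * w + b"
proof -
  obtain u' w' where "u = Suc u'" "w = Suc w'"
    using assms by (metis gr0_conv_Suc)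
  then show ?thesis
    by (simp add: add_mult_distrib add_mult_distrib2)
qed

lemma mult_supermodular_pred: "mult_supermodular (\<lambda>n. n - 1)"
proof -
  have "b * u - 1 + (b * w - 1) \<le> b * u * w - 1 + (b - 1)" if "0 < b" "0 < u" "0 < w" for b u w :: nat
  proof -
    have "1 \<le> b * u" "1 \<le> b * w" "1 \<le> b * u * w"
      using that by simp_all
    then show ?thesis
      using four_point_identity[OF that(2,3), of b] that(1) by linarith
  qed
  then show ?thesis
    by (simp add: mult_supermodular_def)
qed

text \<open>
  Compared with the exact identity above, halving loses the parities of the four terms. They are
  unfavourable only for \<open>b\<close> odd and \<open>u\<close>, \<open>w\<close> even, and in this case the term
  \<open>b (u - 1) (w - 1)\<close> of the identity is positive and makes up for the loss.
\<close>

lemma mult_supermodular_half: "mult_supermodular (\<lambda>n. n div 2)"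
proof -
  have "b * u div 2 + b * w div 2 \<le> b * u * w div 2 + b div 2"
    if "0 < b" "0 < u" "0 < w" for b u w :: nat
  proof (cases "even b \<or> odd u \<or> odd w")
    case True
    then have "b * u * w mod 2 + b mod 2 \<le> b * u mod 2 + b * w mod 2"
      by (cases "even b"; cases "even u"; cases "even w") (auto simp: mod2_eq_if)
    moreover have "b * u + b * w \<le> b * u * w + b"
      using four_point_identity[OF that(2,3), of b] by (metis le_add1)
    moreover have "p + q \<le> r + s"
      if "r' + s' \<le> p' + q'" "(2 * p + p') + (2 * q + q') \<le> (2 * r + r') + (2 * s + s')"
      for p q r s p' q' r' s' :: nat
      using that by linarith
    from this[of "b * u * w mod 2" "b mod 2" "b * u mod 2" "b * w mod 2"
        "b * u div 2" "b * w div 2" "b * u * w div 2" "b div 2"]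
    have "b * u * w mod 2 + b mod 2 \<le> b * u mod 2 + b * w mod 2 \<Longrightarrow> b * u + b * w \<le> b * u * w + b \<Longrightarrow>
        b * u div 2 + b * w div 2 \<le> b * u * w div 2 + b div 2"
      by (simp only: mult_div_mod_eq)
    ultimately show ?thesis
      by blast
  next
    case False
    then have "2 \<le> u" "2 \<le> w"
      using that by (auto elim!: evenE)
    then have "0 < u - 1" "0 < w - 1"
      by simp_all
    then have "0 < b * ((u - 1) * (w - 1))"
      using that(1) by (simp only: nat_0_less_mult_iff)
    moreover from False have "b * u mod 2 = 0" "b * w mod 2 = 0" "b * u * w mod 2 = 0" "b mod 2 = 1"
      by (auto simp: mod2_eq_if)
    ultimately show ?thesis
      using four_point_identity[OF that(2,3), of b] by linarith
  qed
  then show ?thesis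
    by (simp add: mult_supermodular_def)
qed

text \<open>
  Run through the chain carrying \<open>z\<^sub>i = gcd (y i) x\<close>, which starts at \<open>x\<close> and ends at \<open>1\<close>. At each
  entry the pair \<open>(y i, z\<^sub>i\<^sub>+\<^sub>1)\<close> is exchanged for \<open>(z\<^sub>i, deflate y x i)\<close>, which has the same product
  and is less unequal as \<open>z\<^sub>i\<^sub>+\<^sub>1\<close> divides \<open>z\<^sub>i\<close> and \<open>z\<^sub>i\<close> divides \<open>y i\<close>; so the cost does not rise.
\<close>

lemma sum_deflate:
  assumes g: "mult_supermodular g" and pos: "\<And>i. 0 < y i" and chain: "\<And>i. y (Suc i) dvd y i"
    and x: "x dvd y 0" and t: "y t = 1"
  shows "g x + (\<Sum>i<t. g (deflate y x i)) \<le> (\<Sum>i<t. g (y i))"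
proof -
  have step: "g (gcd (y i) x) + g (deflate y x i) \<le> g (y i) + g (gcd (y (Suc i)) x)" for i
  proof -
    define b where "b = gcd (y (Suc i)) x"
    have "b dvd gcd (y i) x"
      using chain[of i] by (auto simp: b_def intro: dvd_trans)
    then obtain u where u: "gcd (y i) x = b * u" ..
    obtain w where w: "y i = gcd (y i) x * w"
      using gcd_dvd1[of "y i" x] unfolding dvd_def by blast
    have p: "0 < b" "0 < b * u * w"
      using pos[of i] pos[of "Suc i"] w u by (simp_all add: b_def flip: u w)
    have "y i div gcd (y i) x = w"
      using w p u by (metis mult_pos_pos nat_0_less_mult_iff nonzero_mult_div_cancel_left less_numeral_extra(3))
    then have "deflate y x i = b * w"
      by (simp add: deflate_def b_def mult.commute)
    moreover have "y i = b * u * w"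
      using w u by simp
    moreover have "0 < u" "0 < w"
      using p(2) by (simp_all only: nat_0_less_mult_iff)
    ultimately show ?thesis
      using g p u unfolding mult_supermodular_def b_def[symmetric] by metis
  qed
  have "g (gcd (y 0) x) + (\<Sum>i<j. g (deflate y x i)) \<le> (\<Sum>i<j. g (y i)) + g (gcd (y j) x)" for j
  proof (induction j)
    case (Suc j)
    then show ?case using step[of j] by simp
  qed simp
  from this[of t] show ?thesis
    using x t g by (simp add: gcd_nat.absorb2 mult_supermodular_def)
qed

text \<open>
  Invariant factors are listed with the largest first and padded with ones, so that the product of
  the \<open>j\<close> largest is \<open>\<Prod>i<j. y i\<close> for every \<open>j\<close>.
\<close>

definition profile :: "nat \<Rightarrow> (nat \<Rightarrow> nat) \<Rightarrow> bool" where
  "profile t y \<longleftrightarrow> (\<forall>i. 0 < y i \<and> y (Suc i) dvd y i) \<and> y t = 1"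

lemma profile_deflate:
  assumes "profile t y" "0 < x"
  shows "profile t (deflate y x)"
proof -
  have "y (Suc t) = 1"
    using assms by (metis profile_def nat_dvd_1_iff_1)
  then show ?thesis
    using assms deflate_pos deflate_dvd by (simp add: profile_def deflate_def)
qed

lemma profile_dvd: "profile t y \<Longrightarrow> i \<le> j \<Longrightarrow> y j dvd y i"
  by (rule inc_induct[of i j "\<lambda>i. y j dvd y i"]) (auto simp: profile_def intro: dvd_trans)

lemma sum_profile_deflate:
  assumes "mult_supermodular g" "profile t y" "x dvd y 0"
  shows "g x + (\<Sum>i<t. g (deflate y x i)) \<le> (\<Sum>i<t. g (y i))"
  using assms by (intro sum_deflate) (auto simp: profile_def)

section \<open>Words\<close>

primrec words :: "('g, 'b) monoid_scheme \<Rightarrow> 'g set \<Rightarrow> nat \<Rightarrow> 'g set" where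
  "words G T 0 = {\<one>\<^bsub>G\<^esub>}"
| "words G T (Suc n) = (\<lambda>(a, w). a \<otimes>\<^bsub>G\<^esub> w) ` (T \<times> words G T n)"

context finite_comm_group
begin

lemma words_closed: "T \<subseteq> carrier G \<Longrightarrow> words G T n \<subseteq> carrier G"
  by (induction n) auto

lemma words_Suc: "a \<in> T \<Longrightarrow> w \<in> words G T n \<Longrightarrow> a \<otimes> w \<in> words G T (Suc n)"
  by force

lemma words_one: "T \<subseteq> carrier G \<Longrightarrow> a \<in> T \<Longrightarrow> a \<in> words G T 1"
  using words_Suc[of a T \<one> 0] by (auto simp: subset_eq)

lemma words_add:
  assumes T: "T \<subseteq> carrier G" and "u \<in> words G T m" "v \<in> words G T n"
  shows "u \<otimes> v \<in> words G T (m + n)"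
  using assms(2)
proof (induction m arbitrary: u)
  case 0
  have "v \<in> carrier G"
    using assms(3) words_closed[OF T] by blast
  then show ?case
    using 0 assms(3) by simp
next
  case (Suc m)
  then obtain a w where w: "u = a \<otimes> w" "a \<in> T" "w \<in> words G T m"
    by auto
  have "u \<otimes> v = a \<otimes> (w \<otimes> v)"
    using w assms words_closed[OF T] by (simp add: m_assoc subset_eq)
  also have "\<dots> \<in> words G T (Suc (m + n))"
    using w Suc by (intro words_Suc) auto
  finally show ?case
    by simp
qed

lemma words_mono:
  assumes T: "T \<subseteq> carrier G" "\<one> \<in> T" and "m \<le> n"
  shows "words G T m \<subseteq> words G T n"
  using \<open>m \<le> n\<close>
proof (induction rule: dec_induct)
  case (step n)
  have "words G T n \<subseteq> words G T (Suc n)"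
  proof
    fix w assume w: "w \<in> words G T n"
    then show "w \<in> words G T (Suc n)"
      using words_Suc[OF T(2) w] words_closed[OF T(1)] by (auto simp: subset_eq)
  qed
  then show ?case
    using step by blast
qed simp

lemma pow_in_words:
  assumes T: "T \<subseteq> carrier G" "a \<in> T"
  shows "a [^] (n::nat) \<in> words G T n"
proof (induction n)
  case (Suc n)
  then show ?case
    using words_add[OF T(1) Suc words_one[OF T]] by simp
qed simp

lemma int_pow_in_words:
  assumes V: "V \<subseteq> carrier G" "a \<in> V" "inv a \<in> V"
  shows "a [^] (i::int) \<in> words G V (nat \<bar>i\<bar>)"
proof (cases "0 \<le> i")
  case True
  then obtain n where "i = int n"
    by (rule nonneg_int_cases)
  then show ?thesis
    using pow_in_words[OF V(1,2), of n] by (simp add: int_pow_int)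
next
  case False
  then obtain n where "i = - int n"
    by (metis int_cases4 of_nat_0_le_iff)
  moreover have "a \<in> carrier G"
    using V by blast
  ultimately have "a [^] i = inv a [^] n"
    by (simp only: int_pow_neg_int nat_pow_inv)
  then show ?thesis
    using pow_in_words[OF V(1,3), of n] \<open>i = - int n\<close> by simp
qed

section \<open>Growth of subgroups over a subgroup\<close>

text \<open>
  The numerical shadow of "the quotient by \<open>K\<close> has invariant factors bounded by \<open>y\<close>": every
  subgroup of the quotient that is generated by \<open>j\<close> elements has order dividing the product of the
  first \<open>j\<close> entries. The quotient group itself and its decomposition are never formed.
\<close>

definition growth_bound :: "'a set \<Rightarrow> (nat \<Rightarrow> nat) \<Rightarrow> bool" where
  "growth_bound K y \<longleftrightarrow>
     (\<forall>B. B \<subseteq> carrier G \<longrightarrow> card (generate G (K \<union> B)) dvd card K * (\<Prod>i<card B. y i))"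

lemma rel_order_dvd_growth:
  assumes "subgroup K G" "a \<in> carrier G" "growth_bound K y"
  shows "rel_order G K a dvd y 0"
proof -
  have "card (generate G (K \<union> {a})) dvd card K * y 0"
    using assms unfolding growth_bound_def by (auto dest: spec[of _ "{a}"])
  moreover have "0 < card K"
    using finite_subgroup[OF assms(1)] subgroup.one_closed[OF assms(1)] by (auto simp: card_gt_0_iff)
  ultimately show ?thesis
    using card_adjoin[OF assms(1,2)] by simp
qed

text \<open>
  Let \<open>N\<close> be the order of the subgroup generated by \<open>K\<close>, \<open>a\<close> and \<open>B\<close>, and \<open>M\<close> the product of the
  first \<open>card B\<close> entries of \<open>y\<close>. Counting \<open>a\<close> among the generators over \<open>K\<close> shows that \<open>N\<close>
  divides \<open>card K * M * y (card B)\<close>. Adjoining \<open>a\<close> last shows that \<open>N\<close> divides \<open>card K * M * x\<close>,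
  since the relative order of \<open>a\<close> cannot grow with the subgroup. The greatest common divisor of the
  two bounds is the claimed one by \<open>prod_deflate\<close>.
\<close>

lemma growth_bound_adjoin:
  assumes K: "subgroup K G" and a: "a \<in> carrier G" and gb: "growth_bound K y"
  shows "growth_bound (generate G (insert a K)) (deflate y (rel_order G K a))"
  unfolding growth_bound_def
proof (intro allI impI)
  fix B assume B: "B \<subseteq> carrier G"
  define x where "x = rel_order G K a"
  define N where "N = card (generate G (generate G (insert a K) \<union> B))"
  define M where "M = (\<Prod>i<card B. y i)"
  define L where "L = generate G (K \<union> B)"
  have finB: "finite B"
    using B finite_carrier finite_subset by blast
  have KG: "K \<subseteq> carrier G"
    using K by (rule subgroup.subset)
  have L: "subgroup L G"
    unfolding L_def using B KG by (intro generate_is_subgroup) auto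
  have N: "N = card (generate G (insert a (K \<union> B)))"
    using generate_absorb[of "insert a K" B] a B KG by (simp add: N_def)
  have "N dvd card K * (\<Prod>i<card (insert a B). y i)"
    using gb a B unfolding growth_bound_def N by (auto dest: spec[of _ "insert a B"])
  moreover have "(\<Prod>i<card (insert a B). y i) dvd (\<Prod>i<Suc (card B). y i)"
    using finB by (intro prod_dvd_prod_subset) (auto simp: card_insert_if)
  ultimately have "N dvd card K * (\<Prod>i<Suc (card B). y i)"
    by (meson dvd_trans dvd_refl mult_dvd_mono)
  then have 1: "N dvd card K * M * y (card B)"
    by (simp add: M_def mult.assoc)
  have "a [^] x \<in> L"
    using rel_order[OF K a] by (auto simp: L_def x_def intro: generate.incl)
  then have "rel_order G L a dvd x"
    by (rule rel_order_dvd[OF L a])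
  moreover have "card L dvd card K * M"
    using gb B unfolding growth_bound_def L_def M_def by blast
  moreover have "generate G (insert a (K \<union> B)) = generate G (insert a L)"
    using generate_absorb[of "K \<union> B" "{a}"] a B KG by (simp add: L_def)
  ultimately have "N dvd x * (card K * M)"
    unfolding N using card_adjoin[OF L a] by (simp only: mult_dvd_mono)
  then have 2: "N dvd card K * M * x"
    by (simp only: mult.commute)
  have "N dvd gcd (card K * M * y (card B)) (card K * M * x)"
    using 1 2 by simp
  also have "\<dots> = card K * (M * gcd (y (card B)) x)"
    by (simp flip: gcd_mult_distrib_nat)
  also have "\<dots> = card K * ((\<Prod>i<card B. deflate y x i) * gcd (y 0) x)"
    unfolding M_def prod_deflate ..
  also have "gcd (y 0) x = x"
    using rel_order_dvd_growth[OF K a gb] by (simp add: x_def gcd_nat.absorb2)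
  finally show "N dvd card (generate G (insert a K)) * (\<Prod>i<card B. deflate y (rel_order G K a) i)"
    unfolding card_adjoin[OF K a] x_def by (simp add: mult_ac)
qed

text \<open>
  For \<open>j = card B < t\<close> let \<open>d = y j\<close>. The \<open>d\<close>-th powers lie in the subgroup \<open>X\<close> generated by the
  \<open>d\<close>-th powers of the generators; those with index at least \<open>j\<close> are trivial, so the order of \<open>X\<close>
  divides \<open>\<Prod>i<j. y i div d\<close>. Over \<open>X\<close> each of the \<open>j\<close> elements of \<open>B\<close> has relative order
  dividing \<open>d\<close>, which contributes \<open>d ^ j\<close>. For \<open>j \<ge> t\<close> the order of the whole group is a bound.
\<close>

lemma growth_bound_trivial:
  assumes y: "profile t y" and b: "\<And>i. i < t \<Longrightarrow> b i \<in> carrier G"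
    and pow: "\<And>i. i < t \<Longrightarrow> b i [^] y i = \<one>" and gen: "carrier G = generate G (b ` {..<t})"
  shows "growth_bound {\<one>} y"
  unfolding growth_bound_def
proof (intro allI impI)
  fix B assume B: "B \<subseteq> carrier G"
  then have finB: "finite B"
    using finite_carrier finite_subset by blast
  define j where "j = card B"
  have B1: "subgroup (generate G ({\<one>} \<union> B)) G"
    using B by (intro generate_is_subgroup) auto
  show "card (generate G ({\<one>} \<union> B)) dvd card {\<one>} * (\<Prod>i<card B. y i)"
  proof (cases "t \<le> j")
    case True
    have "carrier G \<subseteq> generate G ({\<one>} \<union> b ` {..<t})"
      unfolding gen by (rule mono_generate) auto
    then have "carrier G = generate G ({\<one>} \<union> b ` {..<t})"
      using generate_incl[of "{\<one>} \<union> b ` {..<t}"] b by auto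
    then have "card (carrier G) dvd (\<Prod>i<t. y i)"
      using card_generate_union_dvd[of "{..<t}" b "{\<one>}" y] b pow triv_subgroup by auto
    moreover have "card (generate G ({\<one>} \<union> B)) dvd card (carrier G)"
      using card_subgroup_dvd[OF B1 subgroup_self] subgroup.subset[OF B1] by blast
    moreover have "(\<Prod>i<t. y i) dvd (\<Prod>i<j. y i)"
      using True by (intro prod_dvd_prod_subset) auto
    ultimately show ?thesis
      by (auto simp: j_def intro: dvd_trans)
  next
    case False
    define d where "d = y j"
    define X where "X = generate G ({\<one>} \<union> (\<lambda>i. b i [^] d) ` {..<t})"
    have X: "subgroup X G"
      unfolding X_def using b by (intro generate_is_subgroup) auto
    have dvd: "d dvd y i" if "i < j" for i
      using profile_dvd[OF y, of i j] that by (simp add: d_def)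
    have pow_d: "g [^] d \<in> X" if "g \<in> generate G (b ` {..<t})" for g
      using that
    proof induction
      case one
      then show ?case
        using X by (simp add: subgroup.one_closed)
    next
      case (incl h)
      then show ?case
        unfolding X_def by (intro generate.incl) auto
    next
      case (inv h)
      then obtain i where i: "i < t" "h = b i"
        by auto
      have "h [^] d \<in> X"
        using i unfolding X_def by (intro generate.incl) auto
      then show ?case
        using X i b by (simp add: nat_pow_inv subgroup.m_inv_closed)
    next
      case (eng h1 h2)
      then have "h1 \<in> carrier G" "h2 \<in> carrier G"
        using gen by auto
      then show ?case
        using eng X by (simp add: nat_pow_distrib subgroup.m_closed)
    qed
    have "card X dvd (\<Prod>i<t. if i < j then y i div d else 1)"
    proof -
      have "(b i [^] d) [^] (if i < j then y i div d else 1) = \<one>" if "i < t" for i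
      proof (cases "i < j")
        case True
        then show ?thesis
          using dvd that b pow by (simp add: nat_pow_pow)
      next
        case False
        then have "y i dvd d"
          using profile_dvd[OF y, of j i] by (simp add: d_def)
        then obtain q where "d = y i * q" ..
        then show ?thesis
          using that b pow False by (simp flip: nat_pow_pow)
      qed
      then show ?thesis
        using card_generate_union_dvd[of "{..<t}" "\<lambda>i. b i [^] d" "{\<one>}"
          "\<lambda>i. if i < j then y i div d else 1"] b triv_subgroup
        by (auto simp: X_def)
    qed
    also have "(\<Prod>i<t. if i < j then y i div d else 1) = (\<Prod>i<j. y i div d)"
    proof -
      have "{..<t} \<inter> {i. i < j} = {..<j}"
        using False by auto
      then show ?thesis
        by (simp add: prod.If_cases)
    qed
    finally have "card X * d ^ j dvd (\<Prod>i<j. y i div d) * d ^ j"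
      by (simp add: mult_dvd_mono)
    also have "\<dots> = (\<Prod>i<j. y i div d * d)"
      by (simp add: prod.distrib)
    also have "\<dots> = (\<Prod>i<j. y i)"
      using dvd by (intro prod.cong) auto
    finally have 1: "card X * d ^ j dvd (\<Prod>i<j. y i)" .
    have "card (generate G (X \<union> B)) dvd card X * d ^ j"
      using card_generate_union_dvd[of B "\<lambda>b. b" X "\<lambda>_. d"] finB B X pow_d gen
      by (auto simp: j_def)
    moreover have "card (generate G ({\<one>} \<union> B)) dvd card (generate G (X \<union> B))"
    proof (rule card_subgroup_dvd[OF B1])
      show "subgroup (generate G (X \<union> B)) G"
        using X B by (intro generate_is_subgroup) (auto simp: subgroup.subset)
      show "generate G ({\<one>} \<union> B) \<subseteq> generate G (X \<union> B)"
        using X by (intro mono_generate) (auto simp: subgroup.one_closed)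
    qed
    ultimately show ?thesis
      using 1 by (auto simp: j_def intro: dvd_trans)
  qed
qed

section \<open>Covering a generated subgroup by short words\<close>

text \<open>
  The letters of \<open>F\<close> are adjoined to \<open>K\<close> in turn. A letter of relative order \<open>x\<close> is used at most
  \<open>x - 1\<close> times, and deflating the profile by \<open>x\<close> pays for this.
\<close>

lemma generate_words:
  assumes "finite F" "F \<subseteq> T" and T: "T \<subseteq> carrier G" "\<one> \<in> T"
    and "subgroup K G" "growth_bound K y" "profile t y" "h \<in> generate G (K \<union> F)"
  shows "\<exists>k\<in>K. \<exists>w\<in>words G T (\<Sum>i<t. y i - 1). h = k \<otimes> w"
  using assms(1,2,5-8)
proof (induction arbitrary: K y h)
  case empty
  then have "h \<in> K"
    by (simp add: generate_subgroup_self)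
  moreover have "\<one> \<in> words G T (\<Sum>i<t. y i - 1)"
    using words_mono[OF T, of 0] by auto
  ultimately show ?case
    using empty by (metis r_one subgroup.mem_carrier)
next
  case (insert a F)
  define x where "x = rel_order G K a"
  define K' where "K' = generate G (insert a K)"
  have K: "subgroup K G" and a: "a \<in> carrier G" and aT: "a \<in> T" and FG: "F \<subseteq> carrier G"
    using insert T by auto
  have x: "0 < x" "x dvd y 0"
    using rel_order[OF K a] rel_order_dvd_growth[OF K a] insert.prems by (auto simp: x_def)
  have "h \<in> generate G (K' \<union> F)"
    using insert.prems generate_absorb[of "insert a K" F] K a FG by (simp add: K'_def subgroup.subset)
  then obtain k' w where w: "k' \<in> K'" "w \<in> words G T (\<Sum>i<t. deflate y x i - 1)" "h = k' \<otimes> w"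
    using insert.IH[of K' "deflate y x" h] growth_bound_adjoin[OF K a] profile_deflate[OF _ x(1)]
      subgroup_adjoin[OF K a] insert.prems by (auto simp: K'_def x_def)
  obtain k i where k: "k \<in> K" "0 \<le> i" "i < int x" "k' = k \<otimes> a [^] i"
    using adjoin_mem_window[OF K a, of k' 0] w by (auto simp: x_def K'_def)
  have "nat i + (\<Sum>i<t. deflate y x i - 1) \<le> x - 1 + (\<Sum>i<t. deflate y x i - 1)"
    using k by linarith
  also have "\<dots> \<le> (\<Sum>i<t. y i - 1)"
    using sum_profile_deflate[OF mult_supermodular_pred, of t y x] x(2) insert.prems by simp
  finally have "words G T (nat i + (\<Sum>i<t. deflate y x i - 1)) \<subseteq> words G T (\<Sum>i<t. y i - 1)"
    by (rule words_mono[OF T])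
  moreover have "a [^] nat i \<otimes> w \<in> words G T (nat i + (\<Sum>i<t. deflate y x i - 1))"
    by (rule words_add[OF T(1) pow_in_words[OF T(1) aT] w(2)])
  moreover have "h = k \<otimes> (a [^] nat i \<otimes> w)"
    using w k K a words_closed[OF T(1)] by (simp add: m_assoc subgroup.mem_carrier subset_eq flip: int_pow_int)
  ultimately show ?case
    using k by blast
qed

text \<open>
  The same with centred exponents. The letter \<open>s\<close>, which need not lie in \<open>V\<close>, is adjoined last:
  its exponent is then reduced modulo a divisor of \<open>e\<close> and stays separate from the rest of the
  word, while it still counts towards the same total cost.
\<close>

lemma generate_symmetric_words:
  assumes "finite F" "F \<subseteq> V" and V: "V \<subseteq> carrier G" "\<one> \<in> V" "\<And>v. v \<in> V \<Longrightarrow> inv v \<in> V"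
    and s: "s \<in> carrier G" "s [^] e = \<one>" "0 < e"
    and "subgroup K G" "growth_bound K y" "profile t y" "h \<in> generate G (K \<union> F \<union> {s})"
  shows "\<exists>k\<in>K. \<exists>n. \<exists>w\<in>words G V n. \<exists>i::int. h = k \<otimes> w \<otimes> s [^] i \<and>
    n + nat \<bar>i\<bar> \<le> (\<Sum>i<t. y i div 2) \<and> - int ((e - 1) div 2) \<le> i \<and> i \<le> int (e div 2)"
  using assms(1,2,9-12)
proof (induction arbitrary: K y h)
  case empty
  define x where "x = rel_order G K s"
  have K: "subgroup K G"
    using empty by simp
  have "x dvd e"
    using rel_order_dvd[OF K s(1), of e] s K by (simp add: x_def subgroup.one_closed)
  then have xe: "x \<le> e"
    using s by (simp add: dvd_imp_le)
  obtain k i where k: "k \<in> K" "- int ((x - 1) div 2) \<le> i" "i < - int ((x - 1) div 2) + int x" "h = k \<otimes> s [^] i"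
    using adjoin_mem_window[OF K s(1), of h "- int ((x - 1) div 2)"] empty by (auto simp: x_def)
  have x: "0 < x" "x dvd y 0"
    using rel_order[OF K s(1)] rel_order_dvd_growth[OF K s(1)] empty by (auto simp: x_def)
  have "x div 2 \<le> (\<Sum>i<t. y i div 2)"
    using sum_profile_deflate[OF mult_supermodular_half, of t y x] x(2) empty by fastforce
  moreover have "i \<le> int (x div 2)" "nat \<bar>i\<bar> \<le> x div 2"
    using k x by linarith+
  moreover have "- int ((e - 1) div 2) \<le> i" "i \<le> int (e div 2)"
    using xe k x by linarith+
  moreover have "h = k \<otimes> \<one> \<otimes> s [^] i"
    using k K by (simp add: subgroup.mem_carrier)
  ultimately show ?case
    using k by (intro bexI[of _ k] exI[of _ 0] bexI[of _ \<one>] exI[of _ i]) auto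
next
  case (insert a F)
  define x where "x = rel_order G K a"
  define K' where "K' = generate G (insert a K)"
  have K: "subgroup K G" and a: "a \<in> carrier G" and aV: "a \<in> V" "inv a \<in> V" and FG: "F \<subseteq> carrier G"
    using insert V by auto
  have x: "0 < x" "x dvd y 0"
    using rel_order[OF K a] rel_order_dvd_growth[OF K a] insert.prems by (auto simp: x_def)
  have "h \<in> generate G (K' \<union> F \<union> {s})"
    using insert.prems generate_absorb[of "insert a K" "F \<union> {s}"] K a s FG
    by (simp add: K'_def subgroup.subset insert_commute)
  then obtain k' n w i where w: "k' \<in> K'" "w \<in> words G V n" "h = k' \<otimes> w \<otimes> s [^] (i::int)"
      "n + nat \<bar>i\<bar> \<le> (\<Sum>i<t. deflate y x i div 2)" "- int ((e - 1) div 2) \<le> i" "i \<le> int (e div 2)"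
    using insert.IH[of K' "deflate y x" h] growth_bound_adjoin[OF K a] profile_deflate[OF _ x(1)]
      subgroup_adjoin[OF K a] insert.prems by (auto simp: K'_def x_def)
  obtain k j where k: "k \<in> K" "- int ((x - 1) div 2) \<le> j" "j < - int ((x - 1) div 2) + int x"
      "k' = k \<otimes> a [^] j"
    using adjoin_mem_window[OF K a, of k' "- int ((x - 1) div 2)"] w by (auto simp: x_def K'_def)
  have "nat \<bar>j\<bar> + (n + nat \<bar>i\<bar>) \<le> x div 2 + (\<Sum>i<t. deflate y x i div 2)"
    using k x w(4) by linarith
  also have "\<dots> \<le> (\<Sum>i<t. y i div 2)"
    using sum_profile_deflate[OF mult_supermodular_half, of t y x] x(2) insert.prems by simp
  finally have "nat \<bar>j\<bar> + n + nat \<bar>i\<bar> \<le> (\<Sum>i<t. y i div 2)"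
    by simp
  moreover have "a [^] j \<otimes> w \<in> words G V (nat \<bar>j\<bar> + n)"
    by (rule words_add[OF V(1) int_pow_in_words[OF V(1) aV] w(2)])
  moreover have "h = k \<otimes> (a [^] j \<otimes> w) \<otimes> s [^] i"
    using w k K a words_closed[OF V(1)] by (simp add: m_assoc subgroup.mem_carrier subset_eq)
  ultimately show ?case
    using k w by blast
qed

end

context finite_comm_group
begin

section \<open>Splitting and rearranging words\<close>

lemma words_split:
  assumes T: "T \<subseteq> carrier G" and "w \<in> words G T (m + n)"
  obtains u v where "u \<in> words G T m" "v \<in> words G T n" "w = u \<otimes> v"
proof -
  have "\<exists>u\<in>words G T m. \<exists>v\<in>words G T n. w = u \<otimes> v"
    using assms(2)
  proof (induction m arbitrary: w)
    case 0
    then have "w \<in> carrier G"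
      using words_closed[OF T, of n] by auto
    then show ?case
      using 0 by (intro bexI[of _ \<one>] bexI[of _ w]) auto
  next
    case (Suc m)
    then obtain a w' where w: "w = a \<otimes> w'" "a \<in> T" "w' \<in> words G T (m + n)"
      by auto
    then obtain u v where uv: "u \<in> words G T m" "v \<in> words G T n" "w' = u \<otimes> v"
      using Suc.IH by blast
    have "a \<in> carrier G" "u \<in> carrier G" "v \<in> carrier G"
      using w uv T words_closed[OF T] by blast+
    then have "w = a \<otimes> u \<otimes> v"
      using w uv by (simp add: m_assoc)
    then show ?case
      using words_Suc[OF w(2) uv(1)] uv(2) by blast
  qed
  then show thesis
    using that by blast
qed

lemma words_subset: "T \<subseteq> T' \<Longrightarrow> words G T n \<subseteq> words G T' n"
  by (induction n) force+

lemma words_inv: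
  assumes V: "V \<subseteq> carrier G" "\<And>v. v \<in> V \<Longrightarrow> inv v \<in> V" and "w \<in> words G V n"
  shows "inv w \<in> words G V n"
  using assms(3)
proof (induction n arbitrary: w)
  case (Suc n)
  then obtain a u where w: "w = a \<otimes> u" "a \<in> V" "u \<in> words G V n"
    by auto
  have "a \<in> carrier G" "u \<in> carrier G"
    using w V words_closed[OF V(1)] by blast+
  then have "inv w = inv a \<otimes> inv u"
    using w by (simp add: inv_mult)
  then show ?case
    using words_Suc[OF V(2)[OF w(2)] Suc.IH[OF w(3)]] by simp
qed simp

text \<open>
  Omitting trivial factors at the end, a non-trivial product of factors from \<open>S \<union> {1}\<close> ends with
  a factor from \<open>S\<close>. This is needed because the operators see a group element only
  through its effect on the base point, and elements of \<open>S\<close> are those that send it into \<open>I\<close>.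
\<close>

lemma words_insert_one_last:
  assumes S: "S \<subseteq> carrier G" and "u \<in> words G (insert \<one> S) m" "u \<noteq> \<one>"
  obtains u' s where "u' \<in> words G (insert \<one> S) (m - 1)" "s \<in> S" "u = u' \<otimes> s"
proof -
  have "u = \<one> \<or> (\<exists>u'\<in>words G (insert \<one> S) (m - 1). \<exists>s\<in>S. u = u' \<otimes> s)"
    using assms(2)
  proof (induction m arbitrary: u)
    case (Suc m)
    have T: "insert \<one> S \<subseteq> carrier G"
      using S by simp
    obtain a v where u: "u = a \<otimes> v" "a \<in> insert \<one> S" "v \<in> words G (insert \<one> S) m"
      using Suc.prems by auto
    have c: "a \<in> carrier G" "v \<in> carrier G"
      using u T words_closed[OF T] by blast+
    from Suc.IH[OF u(3)] show ?case
    proof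
      assume "v = \<one>"
      then have ua: "u = \<one> \<otimes> a"
        using u c by simp
      have "\<one> \<in> words G (insert \<one> S) (Suc m - 1)"
        using words_mono[OF T, of 0 m] by simp
      then show ?thesis
        using u(2) ua by auto
    next
      assume "\<exists>u'\<in>words G (insert \<one> S) (m - 1). \<exists>s\<in>S. v = u' \<otimes> s"
      then obtain u' s where v: "u' \<in> words G (insert \<one> S) (m - 1)" "s \<in> S" "v = u' \<otimes> s"
        by blast
      have c': "u' \<in> carrier G" "s \<in> carrier G"
        using v S words_closed[OF T] by blast+
      show ?thesis
      proof (cases m)
        case 0
        then have "v = \<one>"
          using u(3) by simp
        then have ua: "u = \<one> \<otimes> a"
          using u c by simp
        then show ?thesis
          using u(2) 0 by auto
      next
        case (Suc m')
        then have "a \<otimes> u' \<in> words G (insert \<one> S) (Suc m - 1)"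
          using words_Suc[OF u(2) v(1)] by simp
        moreover have "u = a \<otimes> u' \<otimes> s"
          using u v c c' by (simp add: m_assoc)
        ultimately show ?thesis
          using v(2) by blast
      qed
    qed
  qed simp
  then show thesis
    using that assms(3) by blast
qed

end

section \<open>The two operators\<close>

locale pointed_action = finite_comm_group G for G (structure) +
  fixes A :: "('x, 'a) pointed_gset"
  assumes pointed_gset: "A \<in> pointed_gsets G"
begin


lemma base_closed: "pt A \<in> carrier A"
  and act_closed: "g \<in> carrier G \<Longrightarrow> x \<in> carrier A \<Longrightarrow> act A g x \<in> carrier A"
  and act_one: "x \<in> carrier A \<Longrightarrow> act A \<one> x = x"
  and act_act: "g \<in> carrier G \<Longrightarrow> h \<in> carrier G \<Longrightarrow> x \<in> carrier A \<Longrightarrow> act A g (act A h x) = act A (g \<otimes> h) x"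
  using pointed_gset by (auto simp: pointed_gsets_def)

lemma gen_semicong_eq:
  assumes I: "I \<subseteq> carrier A"
  shows "gen_semicong G A I =
    Id_on (carrier A) \<union> {(act A g i, act A g (pt A)) |g i. g \<in> carrier G \<and> i \<in> I}" (is "_ = ?R")
proof
  have "semicongruence G A ?R"
    unfolding semicongruence_def subalgebra_def square_alg_def refl_on_def
    using I base_closed act_closed by (auto simp: act_act subset_eq Id_on_def) (use act_act in blast)+
  moreover have "(i, pt A) \<in> ?R" if "i \<in> I" for i
  proof -
    have "(i, pt A) = (act A \<one> i, act A \<one> (pt A))"
      using that I base_closed act_one by auto
    then show ?thesis
      using that by blast
  qed
  then have "I \<times> {pt A} \<subseteq> ?R"
    by blast
  ultimately show "gen_semicong G A I \<subseteq> ?R"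
    by (rule gen_semicong_least(3)[OF pointed_gset I])
  show "?R \<subseteq> gen_semicong G A I"
  proof -
    have semi: "semicongruence G A (gen_semicong G A I)"
      and incl: "I \<times> {pt A} \<subseteq> gen_semicong G A I"
      using gen_semicong_least(1,2)[OF pointed_gset I] by blast+
    have "(act A g i, act A g (pt A)) \<in> gen_semicong G A I" if "g \<in> carrier G" "i \<in> I" for g i
    proof -
      have "act (square_alg A) g (i, pt A) \<in> gen_semicong G A I"
        using semi incl that unfolding semicongruence_def subalgebra_def by blast
      then show ?thesis
        by (simp add: square_alg_def)
    qed
    moreover have "Id_on (carrier A) \<subseteq> gen_semicong G A I"
      using semi by (auto simp: semicongruence_def refl_on_def)
    ultimately show ?thesis
      by blast
  qed
qed

lemma ind_op_eq:
  assumes "I \<subseteq> carrier A"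
  shows "ind_op G A I = I \<union> {act A g i |g i. g \<in> carrier G \<and> i \<in> I \<and> act A g (pt A) \<in> I}"
  unfolding ind_op_def gen_semicong_eq[OF assms] using assms act_closed by (auto simp: Id_on_iff)

lemma ded_op_eq:
  assumes "I \<subseteq> carrier A"
  shows "ded_op G A I = I \<union> {act A g (pt A) |g i. g \<in> carrier G \<and> i \<in> I \<and> act A g i \<in> I}"
  unfolding ded_op_def gen_semicong_eq[OF assms] using assms act_closed base_closed
  by (auto simp: Id_on_iff)

lemma ind_iter_closed: "I \<subseteq> carrier A \<Longrightarrow> (ind_op G A ^^ n) I \<subseteq> carrier A"
  by (induction n) (auto simp: ind_op_def)

lemma ded_iter_closed: "I \<subseteq> carrier A \<Longrightarrow> (ded_op G A ^^ n) I \<subseteq> carrier A"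
  by (induction n) (auto simp: ded_op_def)

lemma ind_iter_Suc:
  assumes "I \<subseteq> carrier A"
  shows "(ind_op G A ^^ Suc n) I = (ind_op G A ^^ n) I \<union>
    {act A g i |g i. g \<in> carrier G \<and> i \<in> (ind_op G A ^^ n) I \<and> act A g (pt A) \<in> (ind_op G A ^^ n) I}"
  using ind_op_eq[OF ind_iter_closed[OF assms]] by simp

lemma ded_iter_Suc:
  assumes "I \<subseteq> carrier A"
  shows "(ded_op G A ^^ Suc n) I = (ded_op G A ^^ n) I \<union>
    {act A g (pt A) |g i. g \<in> carrier G \<and> i \<in> (ded_op G A ^^ n) I \<and> act A g i \<in> (ded_op G A ^^ n) I}"
  using ded_op_eq[OF ded_iter_closed[OF assms]] by simp

definition landing :: "'x set \<Rightarrow> 'a set" where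
  "landing I = {g \<in> carrier G. act A g (pt A) \<in> I}"

lemma landing_closed: "landing I \<subseteq> carrier G"
  by (auto simp: landing_def)

section \<open>Upper bound for the inductive rank\<close>

text \<open>
  A word of length \<open>2 ^ Suc n - 1\<close> splits as \<open>u \<otimes> v\<close> with \<open>u\<close> of length \<open>2 ^ n\<close> and \<open>v\<close> of
  length \<open>2 ^ n - 1\<close>. If \<open>u\<close> is not trivial, it ends with some \<open>s\<close> with \<open>s c \<in> I\<close>, so the induction
  hypothesis applied to the point \<open>s c\<close> shows that \<open>u c\<close> has been reached as well, which is
  what allows \<open>u\<close> to act on \<open>v i\<close>.
\<close>

lemma words_act_ind_iter:
  assumes I: "I \<subseteq> carrier A"
  shows "w \<in> words G (insert \<one> (landing I)) (2 ^ n - 1) \<Longrightarrow> i \<in> I \<Longrightarrow> act A w i \<in> (ind_op G A ^^ n) I"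
proof (induction n arbitrary: w i)
  case 0
  then show ?case
    using I act_one by auto
next
  case (Suc n)
  have S: "landing I \<subseteq> carrier G" and T: "insert \<one> (landing I) \<subseteq> carrier G"
    using landing_closed by auto
  have "2 ^ Suc n - 1 = 2 ^ n + (2 ^ n - 1 :: nat)"
    by simp
  then obtain u v where uv: "u \<in> words G (insert \<one> (landing I)) (2 ^ n)"
      "v \<in> words G (insert \<one> (landing I)) (2 ^ n - 1)" "w = u \<otimes> v"
    using words_split[OF T] Suc.prems(1) by metis
  have c: "u \<in> carrier G" "v \<in> carrier G" "i \<in> carrier A"
    using uv words_closed[OF T] I Suc.prems by blast+
  have v: "act A v i \<in> (ind_op G A ^^ n) I"
    by (rule Suc.IH[OF uv(2) Suc.prems(2)])
  show ?case
  proof (cases "u = \<one>")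
    case True
    then show ?thesis
      using v uv c ind_iter_Suc[OF I, of n] by auto
  next
    case False
    from words_insert_one_last[OF S uv(1) False] obtain u' s
      where u: "u' \<in> words G (insert \<one> (landing I)) (2 ^ n - 1)" "s \<in> landing I" "u = u' \<otimes> s"
      by metis
    have c': "u' \<in> carrier G" "s \<in> carrier G"
      using u S words_closed[OF T] by blast+
    have "act A u' (act A s (pt A)) \<in> (ind_op G A ^^ n) I"
      using u by (intro Suc.IH) (auto simp: landing_def)
    then have "act A u (pt A) \<in> (ind_op G A ^^ n) I"
      using u c' base_closed act_act by simp
    moreover have "act A w i = act A u (act A v i)"
      using uv c act_act by simp
    ultimately show ?thesis
      using v c unfolding ind_iter_Suc[OF I] by blast
  qed
qed

lemma ind_iter_subset:
  assumes I: "I \<subseteq> carrier A"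
  shows "(ind_op G A ^^ n) I \<subseteq> {act A h i |h i. h \<in> generate G (landing I) \<and> i \<in> I}"
proof (induction n)
  case 0
  have "i = act A \<one> i" if "i \<in> I" for i
    using that I act_one by auto
  then show ?case
    using generate.one by fastforce
next
  case (Suc n)
  have gen: "generate G (landing I) \<subseteq> carrier G"
    by (rule generate_incl[OF landing_closed])
  have "act A g x \<in> {act A h i |h i. h \<in> generate G (landing I) \<and> i \<in> I}"
    if g: "g \<in> carrier G" and x: "x \<in> (ind_op G A ^^ n) I" and gc: "act A g (pt A) \<in> (ind_op G A ^^ n) I" for g x
  proof -
    obtain h i where h: "h \<in> generate G (landing I)" "i \<in> I" "x = act A h i"
      using Suc x by blast
    obtain h' i' where h': "h' \<in> generate G (landing I)" "i' \<in> I" "act A g (pt A) = act A h' i'"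
      using Suc gc by blast
    have c: "h \<in> carrier G" "h' \<in> carrier G" "i \<in> carrier A" "i' \<in> carrier A"
      using h h' gen I by auto
    have "act A (inv h' \<otimes> g) (pt A) = act A (inv h') (act A h' i')"
      using act_act[of "inv h'" g "pt A"] c g base_closed h' by simp
    also have "\<dots> = i'"
      using act_act[of "inv h'" h' i'] act_one c by simp
    finally have "inv h' \<otimes> g \<in> landing I"
      using h' c g by (simp add: landing_def)
    then have "h' \<otimes> (inv h' \<otimes> g) \<in> generate G (landing I)"
      using h' by (blast intro: generate.eng generate.incl)
    moreover have "h' \<otimes> (inv h' \<otimes> g) = g"
      using c g by (simp flip: m_assoc)
    ultimately have "g \<otimes> h \<in> generate G (landing I)"
      using h by (auto intro: generate.eng)
    moreover have "act A g x = act A (g \<otimes> h) i"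
      using h c g act_act by simp
    ultimately show ?thesis
      using h by blast
  qed
  then show ?case
    unfolding ind_iter_Suc[OF I] using Suc by blast
qed

theorem ind_iter_stable:
  assumes "growth_bound {\<one>} y" "profile t y" "(\<Sum>i<t. y i - 1) \<le> 2 ^ n - 1" and I: "I \<subseteq> carrier A"
  shows "(ind_op G A ^^ n) I = (ind_op G A ^^ (n + 1)) I"
proof
  show "(ind_op G A ^^ n) I \<subseteq> (ind_op G A ^^ (n + 1)) I"
    using ind_iter_Suc[OF I] by simp
  have T: "insert \<one> (landing I) \<subseteq> carrier G"
    using landing_closed by simp
  have "act A h i \<in> (ind_op G A ^^ n) I" if h: "h \<in> generate G (landing I)" and i: "i \<in> I" for h i
  proof -
    have "h \<in> generate G ({\<one>} \<union> landing I)"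
      using h mono_generate[of "landing I" "{\<one>} \<union> landing I"] by auto
    then obtain w where w: "w \<in> words G (insert \<one> (landing I)) (\<Sum>i<t. y i - 1)" "h = \<one> \<otimes> w"
      using generate_words[of "landing I" "insert \<one> (landing I)" "{\<one>}" y t h] assms T triv_subgroup
        finite_subset[OF landing_closed finite_carrier] by auto
    then have "h \<in> words G (insert \<one> (landing I)) (2 ^ n - 1)"
      using words_mono[OF T _ assms(3)] subsetD[OF words_closed[OF T] w(1)] by auto
    then show ?thesis
      using words_act_ind_iter[OF I] i by blast
  qed
  then show "(ind_op G A ^^ (n + 1)) I \<subseteq> (ind_op G A ^^ n) I"
    using ind_iter_subset[OF I, of "n + 1"] by blast
qed

section \<open>Upper bound for the deductive rank\<close>

text \<open>
  The set \<open>V\<close> of the introduction: it records the quotients of elements of \<open>landing I\<close> together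
  with all coincidences of \<open>I\<close> with its translates outside the orbit of the base point.
\<close>

definition transit :: "'x set \<Rightarrow> 'a set" where
  "transit I = {g \<in> carrier G. \<exists>i\<in>I. act A g i \<in> I}"

lemma transit_closed: "transit I \<subseteq> carrier G"
  by (auto simp: transit_def)

lemma transit_inv:
  assumes I: "I \<subseteq> carrier A" and "g \<in> transit I"
  shows "inv g \<in> transit I"
proof -
  obtain i where i: "g \<in> carrier G" "i \<in> I" "act A g i \<in> I"
    using assms by (auto simp: transit_def)
  then have "act A (inv g) (act A g i) = i"
    using I act_act[of "inv g" g i] act_one by auto
  then show ?thesis
    using i unfolding transit_def by (intro CollectI conjI bexI[of _ "act A g i"]) auto
qed

lemma landing_diff_transit:
  assumes "u \<in> landing I" "v \<in> landing I"
  shows "u \<otimes> inv v \<in> transit I"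
proof -
  have c: "u \<in> carrier G" "v \<in> carrier G"
    using assms landing_closed by auto
  then have "act A (u \<otimes> inv v) (act A v (pt A)) = act A u (pt A)"
    using base_closed act_act[of "u \<otimes> inv v" v "pt A"] by (simp add: m_assoc)
  then show ?thesis
    using assms c unfolding transit_def landing_def
    by (intro CollectI conjI bexI[of _ "act A v (pt A)"]) auto
qed

lemma landing_ded_iter_Suc:
  assumes "I \<subseteq> carrier A"
  shows "landing ((ded_op G A ^^ n) I) \<union> transit ((ded_op G A ^^ n) I) \<subseteq> landing ((ded_op G A ^^ Suc n) I)"
  unfolding ded_iter_Suc[OF assms] by (auto simp: landing_def transit_def)

text \<open>
  The doubling step: with \<open>u = a b\<close> and \<open>v = a' b'\<close>, commutativity gives
  \<open>u v\<inverse> = (a a'\<inverse>) (b' b\<inverse>)\<inverse>\<close>, a quotient of two elements that are already available.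
\<close>

lemma words_quotient_ded_iter:
  assumes I: "I \<subseteq> carrier A"
  shows "u \<in> words G (landing (ded_op G A I)) (2 ^ n) \<Longrightarrow> v \<in> words G (landing (ded_op G A I)) (2 ^ n)
    \<Longrightarrow> u \<otimes> inv v \<in> landing ((ded_op G A ^^ (n + 2)) I)"
proof (induction n arbitrary: u v)
  case 0
  have "words G (landing (ded_op G A I)) 1 = landing (ded_op G A I)"
    using landing_closed by (force simp: image_iff)
  then show ?case
    using 0 landing_diff_transit landing_ded_iter_Suc[OF I, of 1] by auto
next
  case (Suc n)
  note cl = landing_closed[of "ded_op G A I"]
  have u: "u \<in> words G (landing (ded_op G A I)) (2 ^ n + 2 ^ n)"
    and v: "v \<in> words G (landing (ded_op G A I)) (2 ^ n + 2 ^ n)"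
    using Suc.prems by (simp_all add: mult_2)
  obtain a b a' b' where w: "u = a \<otimes> b" "v = a' \<otimes> b'"
      "a \<in> words G (landing (ded_op G A I)) (2 ^ n)" "b \<in> words G (landing (ded_op G A I)) (2 ^ n)"
      "a' \<in> words G (landing (ded_op G A I)) (2 ^ n)" "b' \<in> words G (landing (ded_op G A I)) (2 ^ n)"
    by (rule words_split[OF cl u], rule words_split[OF cl v]) blast
  then have c: "a \<in> carrier G" "b \<in> carrier G" "a' \<in> carrier G" "b' \<in> carrier G"
    using words_closed[OF cl] by blast+
  have "(a \<otimes> inv a') \<otimes> inv (b' \<otimes> inv b) \<in> landing ((ded_op G A ^^ Suc (n + 2)) I)"
    using landing_ded_iter_Suc[OF I, of "n + 2"] landing_diff_transit[OF Suc.IH[OF w(3,5)] Suc.IH[OF w(6,4)]]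
    by blast
  moreover have "(a \<otimes> inv a') \<otimes> inv (b' \<otimes> inv b) = u \<otimes> inv v"
    using w c by (simp add: inv_mult m_ac)
  ultimately show ?case
    by simp
qed

text \<open>
  Only points of the orbit of \<open>c\<close> are ever added. If \<open>g c\<close> is added because of \<open>i\<close> and \<open>g i\<close>, each
  of these two points lies in \<open>I\<close> or is of the form \<open>h c\<close> with \<open>h\<close> in the generated subgroup
  \<open>H\<close>. In three of the four cases this forces \<open>g \<in> H\<close>. If both points are of the second kind, \<open>g\<close>
  lies in \<open>H\<close> only up to the stabiliser of \<open>c\<close>, which need not be contained in \<open>H\<close>, but \<open>g c\<close> is still in the
  \<open>H\<close>-orbit.
\<close>

lemma ded_iter_subset:
  assumes I: "I \<subseteq> carrier A"
  shows "(ded_op G A ^^ n) I \<subseteq> I \<union> {act A h (pt A) |h. h \<in> generate G (landing I \<union> transit I)}"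
proof (induction n)
  case 0
  then show ?case by simp
next
  case (Suc n)
  define H where "H = generate G (landing I \<union> transit I)"
  have HG: "subgroup H G"
    unfolding H_def using landing_closed transit_closed by (intro generate_is_subgroup) auto
  have HS: "landing I \<subseteq> H" "transit I \<subseteq> H"
    by (auto simp: H_def intro: generate.incl)
  have *: "act A g (pt A) \<in> I \<union> {act A h (pt A) |h. h \<in> H}"
    if g: "g \<in> carrier G" and i: "i \<in> (ded_op G A ^^ n) I" and gi: "act A g i \<in> (ded_op G A ^^ n) I" for g i
  proof -
    have in_H: "act A g (pt A) \<in> I \<union> {act A h (pt A) |h. h \<in> H}" if "g \<in> H"
      using that by blast
    have ci: "i \<in> carrier A"
      using i ded_iter_closed[OF I] by blast
    have "x \<in> I \<or> (\<exists>h. h \<in> H \<and> x = act A h (pt A))" if "x \<in> (ded_op G A ^^ n) I" for x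
      using subsetD[OF Suc that] by (simp add: H_def) blast
    from this[OF i] this[OF gi]
    consider "i \<in> I" "act A g i \<in> I" | h where "i \<in> I" "h \<in> H" "act A g i = act A h (pt A)"
      | h where "h \<in> H" "i = act A h (pt A)" "act A g i \<in> I"
      | h h' where "h \<in> H" "i = act A h (pt A)" "h' \<in> H" "act A g i = act A h' (pt A)"
      by metis
    then show ?thesis
    proof cases
      case 1
      then show ?thesis
        using g HS by (intro in_H) (auto simp: transit_def)
    next
      case 2
      have c: "h \<in> carrier G"
        using 2 HG subgroup.mem_carrier by metis
      have "act A (inv g \<otimes> h) (pt A) = act A (inv g) (act A g i)"
        using 2 c g act_act[of "inv g" h "pt A"] base_closed by simp
      also have "\<dots> = i"
        using act_act[of "inv g" g i] act_one g ci by simp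
      finally have "inv g \<otimes> h \<in> H"
        using 2 HS c g by (auto simp: landing_def)
      then have "h \<otimes> inv (inv g \<otimes> h) \<in> H"
        using 2 HG by (simp add: subgroup.m_closed subgroup.m_inv_closed)
      moreover have "h \<otimes> inv (inv g \<otimes> h) = g"
        using c g by (simp add: inv_mult m_lcomm)
      ultimately show ?thesis
        by (intro in_H) simp
    next
      case 3
      have c: "h \<in> carrier G"
        using 3 HG subgroup.mem_carrier by metis
      then have "g \<otimes> h \<in> H"
        using 3 HS g act_act[of g h "pt A"] base_closed by (auto simp: landing_def)
      then have "g \<otimes> h \<otimes> inv h \<in> H"
        using 3 HG by (simp add: subgroup.m_closed subgroup.m_inv_closed)
      then show ?thesis
        using c g by (intro in_H) (simp add: m_assoc)
    next
      case 4
      have c: "h \<in> carrier G" "h' \<in> carrier G"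
        using 4 HG subgroup.mem_carrier by metis+
      have "g = inv h \<otimes> (g \<otimes> h)"
        using c g by (simp add: m_lcomm)
      then have "act A g (pt A) = act A (inv h) (act A g (act A h (pt A)))"
        using act_act[of "inv h" "g \<otimes> h" "pt A"] act_act[of g h "pt A"] c g base_closed by simp
      also have "\<dots> = act A (inv h \<otimes> h') (pt A)"
        using 4 act_act[of "inv h" h' "pt A"] c base_closed by simp
      finally show ?thesis
        using 4 HG by (auto simp: subgroup.m_closed subgroup.m_inv_closed)
    qed
  qed
  show ?case
    unfolding ded_iter_Suc[OF I] using Suc * unfolding H_def by blast
qed

text \<open>
  Every element of the subgroup in question is a word of \<open>b\<close> letters from \<open>V\<close> times \<open>s\<close> to the power
  \<open>i\<close>, with \<open>b + \<bar>i\<bar>\<close> at most \<open>2 ^ (n - 1)\<close> and \<open>\<bar>i\<bar>\<close> at most half of the exponent of the group.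
  For \<open>n \<ge> 2\<close> it has to be written as a quotient of two words of length \<open>j = 2 ^ (n - 2)\<close>. The \<open>\<bar>i\<bar>\<close> letters
  \<open>s\<close> must all go to the same side, which is where \<open>y 0 - 1 \<le> 2 * j\<close> is needed; the letters
  from \<open>V\<close> fill up both sides, as \<open>V\<close> is symmetric.
\<close>

theorem ded_iter_stable:
  assumes gb: "growth_bound {\<one>} y" and y: "profile t y"
    and exp: "\<And>g. g \<in> carrier G \<Longrightarrow> g [^] y 0 = \<one>"
    and n: "0 < n" "(\<Sum>i<t. y i div 2) \<le> 2 ^ (n - 1)" "y 0 - 1 \<le> 2 ^ (n - 1)"
    and I: "I \<subseteq> carrier A" "I \<noteq> {}"
  shows "(ded_op G A ^^ n) I = (ded_op G A ^^ (n + 1)) I"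
proof
  show "(ded_op G A ^^ n) I \<subseteq> (ded_op G A ^^ (n + 1)) I"
    using ded_iter_Suc[OF I(1)] by simp
  define V where "V = transit I"
  define L where "L = landing (ded_op G A I)"
  \<comment> \<open>If no translate of the base point lies in \<open>I\<close>, then \<open>V\<close> alone generates and \<open>\<one> \<in> V\<close> serves as \<open>s\<close>.\<close>
  define s where "s = (if landing I = {} then \<one> else SOME s. s \<in> landing I)"
  have V: "V \<subseteq> carrier G" "\<And>v. v \<in> V \<Longrightarrow> inv v \<in> V"
    using transit_closed transit_inv[OF I(1)] by (auto simp: V_def)
  have V1: "\<one> \<in> V"
    using I act_one by (force simp: V_def transit_def)
  have s: "s \<in> carrier G" "landing I \<noteq> {} \<Longrightarrow> s \<in> landing I"
    using some_in_eq[of "landing I"] landing_closed by (auto simp: s_def)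
  have L: "L \<subseteq> carrier G" "V \<subseteq> L" "s \<in> L"
    using landing_closed landing_ded_iter_Suc[OF I(1), of 0] s V1 by (auto simp: L_def V_def s_def split: if_splits)
  have "landing I \<union> V \<subseteq> generate G ({\<one>} \<union> V \<union> {s})"
  proof
    fix g assume "g \<in> landing I \<union> V"
    then show "g \<in> generate G ({\<one>} \<union> V \<union> {s})"
    proof
      assume g: "g \<in> landing I"
      then have "g \<otimes> inv s \<in> V"
        using landing_diff_transit s by (auto simp: V_def)
      then have "(g \<otimes> inv s) \<otimes> s \<in> generate G ({\<one>} \<union> V \<union> {s})"
        by (intro generate.eng generate.incl) auto
      then show ?thesis
        using g s landing_closed[of I] by (simp add: m_assoc subset_eq)
    qed (auto intro: generate.incl)
  qed
  then have gen: "generate G (landing I \<union> transit I) \<subseteq> generate G ({\<one>} \<union> V \<union> {s})"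
    using V s by (intro generate_subgroup_incl generate_is_subgroup) (auto simp: V_def)
  have "h \<in> landing ((ded_op G A ^^ n) I)" if h: "h \<in> generate G ({\<one>} \<union> V \<union> {s})" for h
  proof -
    have y0: "0 < y 0"
      using y by (simp add: profile_def)
    obtain b w i where w: "w \<in> words G V b" "h = \<one> \<otimes> w \<otimes> s [^] (i::int)"
        "b + nat \<bar>i\<bar> \<le> (\<Sum>i<t. y i div 2)" "- int ((y 0 - 1) div 2) \<le> i" "i \<le> int (y 0 div 2)"
      using generate_symmetric_words[of V V s "y 0" "{\<one>}" y t h] V V1 s exp y0 triv_subgroup gb y h
        finite_subset[OF V(1) finite_carrier] by auto
    have wc: "w \<in> carrier G"
      using w words_closed[OF V(1)] by blast
    show ?thesis
    \<comment> \<open>For \<open>n = 1\<close> quotients are not yet available, but then the asymmetric window for exponents modulo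
      \<open>y 0 \<le> 2\<close> excludes the exponent \<open>-1\<close>.\<close>
    proof (cases "n = 1")
      case True
      then have "y 0 \<le> 2" "b + nat \<bar>i\<bar> \<le> 1"
        using n w by auto
      then have "i = 0 \<and> b \<le> 1 \<or> i = 1 \<and> b = 0"
        using w(4,5) by (cases "y 0 = 2") (auto simp: le_Suc_eq numeral_2_eq_2)
      then have "h \<in> L"
      proof
        assume *: "i = 0 \<and> b \<le> 1"
        then have "w \<in> words G V 1"
          using words_mono[OF V(1) V1, of b 1] w by auto
        then have "w \<in> V"
          using V by (auto simp: subset_eq)
        then show "h \<in> L"
          using w wc * L by auto
      next
        assume "i = 1 \<and> b = 0"
        then show "h \<in> L"
          using w s L by simp
      qed
      then show ?thesis
        using True by (simp add: L_def)
    next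
      case False
      then obtain m where m: "n = m + 2"
        using n by (metis add_2_eq_Suc' gr0_conv_Suc nat_neq_iff less_one not0_implies_Suc One_nat_def)
      define j :: nat where "j = 2 ^ m"
      have jb: "b + nat \<bar>i\<bar> \<le> j + j" and "y 0 - 1 \<le> 2 * j"
        using w(3) n m by (auto simp: j_def)
      \<comment> \<open>As \<open>2 * j\<close> is even, \<open>y 0 - 1 \<le> 2 * j\<close> already gives \<open>y 0 div 2 \<le> j\<close>.\<close>
      then have ij: "nat \<bar>i\<bar> \<le> j"
        using w(4,5) y0 by linarith
      define k where "k = nat \<bar>i\<bar>"
      have "b \<le> j - k + j"
        using jb ij by (simp add: k_def)
      then have "w \<in> words G V (j - k + j)"
        using words_mono[OF V(1) V1] w(1) by blast
      then obtain w1 w2 where w12: "w1 \<in> words G V (j - k)" "w2 \<in> words G V j" "w = w1 \<otimes> w2"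
        using words_split[OF V(1)] by metis
      have c: "w1 \<in> carrier G" "w2 \<in> carrier G"
        using w12 words_closed[OF V(1)] by blast+
      have long: "u \<otimes> s [^] k \<in> words G L j" if "u \<in> words G V (j - k)" for u
        using words_add[OF L(1) subsetD[OF words_subset[OF L(2)] that] pow_in_words[OF L(1,3), of k]] ij
        by (simp add: k_def)
      have "h \<in> landing ((ded_op G A ^^ (m + 2)) I)"
      proof (cases "0 \<le> i")
        case True
        then have "i = int k"
          by (simp add: k_def)
        then have "h = (w1 \<otimes> s [^] k) \<otimes> inv (inv w2)"
          using w(2) w12 c s by (simp add: int_pow_int m_ac)
        moreover have "inv w2 \<in> words G L j"
          using words_inv[OF V w12(2)] words_subset[OF L(2)] by blast
        ultimately show ?thesis
          using words_quotient_ded_iter[OF I(1), of _ m] long[OF w12(1)] by (simp add: j_def L_def)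
      next
        case False
        then have "i = - int k"
          by (simp add: k_def)
        then have "h = w2 \<otimes> inv (inv w1 \<otimes> s [^] k)"
          using w(2) w12 c s by (simp add: int_pow_neg_int inv_mult m_ac)
        moreover have "w2 \<in> words G L j"
          using w12(2) words_subset[OF L(2)] by blast
        ultimately show ?thesis
          using words_quotient_ded_iter[OF I(1), of _ m] long[OF words_inv[OF V w12(1)]]
          by (simp add: j_def L_def)
      qed
      then show ?thesis
        using m by simp
    qed
  qed
  then have "act A h (pt A) \<in> (ded_op G A ^^ n) I" if "h \<in> generate G (landing I \<union> transit I)" for h
    using that gen by (auto simp: landing_def)
  moreover have "I \<subseteq> (ded_op G A ^^ k) I" for k
    by (induction k) (use ded_iter_Suc[OF I(1)] in auto)
  ultimately show "(ded_op G A ^^ (n + 1)) I \<subseteq> (ded_op G A ^^ n) I"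
    using ded_iter_subset[OF I(1), of "n + 1"] by blast
qed

end

section \<open>Finite free pointed sets\<close>

text \<open>
  The points are named by an injection \<open>\<iota>\<close>, since the carrier must be a subset of a given infinite
  type. The orbit with index \<open>0\<close> contains the base point; the others are further free orbits.
\<close>

definition free_gset :: "('g, 'b) monoid_scheme \<Rightarrow> nat \<Rightarrow> ('g \<times> nat \<Rightarrow> 'x) \<Rightarrow> ('x, 'g) pointed_gset" where
  "free_gset G N \<iota> = \<lparr>carrier = \<iota> ` (carrier G \<times> {..N}),
     act = (\<lambda>g x. case inv_into (carrier G \<times> {..N}) \<iota> x of (h, i) \<Rightarrow> \<iota> (g \<otimes>\<^bsub>G\<^esub> h, i)),
     pt = \<iota> (\<one>\<^bsub>G\<^esub>, 0)\<rparr>"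

locale free_pointed_action = finite_comm_group G for G (structure) +
  fixes N :: nat and \<iota> :: "'a \<times> nat \<Rightarrow> 'x"
  assumes inj: "inj_on \<iota> (carrier G \<times> {..N})"
begin

lemma act_free: "h \<in> carrier G \<Longrightarrow> i \<le> N \<Longrightarrow> act (free_gset G N \<iota>) g (\<iota> (h, i)) = \<iota> (g \<otimes> h, i)"
  using inj by (simp add: free_gset_def)

lemma carrier_free: "carrier (free_gset G N \<iota>) = \<iota> ` (carrier G \<times> {..N})"
  and pt_free: "pt (free_gset G N \<iota>) = \<iota> (\<one>, 0)"
  by (simp_all add: free_gset_def)

lemma free_gset_in: "free_gset G N \<iota> \<in> pointed_gsets G"
  unfolding pointed_gsets_def mem_Collect_eq
  by (auto simp: carrier_free pt_free act_free m_assoc)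

sublocale pointed_action G "free_gset G N \<iota>"
  by unfold_locales (rule free_gset_in)

definition level :: "'x set \<Rightarrow> nat \<Rightarrow> 'a set" where
  "level I i = {g \<in> carrier G. \<iota> (g, i) \<in> I}"

lemma iota_eq_iff:
  "g \<in> carrier G \<Longrightarrow> h \<in> carrier G \<Longrightarrow> i \<le> N \<Longrightarrow> j \<le> N \<Longrightarrow> \<iota> (g, i) = \<iota> (h, j) \<longleftrightarrow> g = h \<and> i = j"
  using inj_on_eq_iff[OF inj, of "(g, i)" "(h, j)"] by auto

lemma act_pt_free: "g \<in> carrier G \<Longrightarrow> act (free_gset G N \<iota>) g (pt (free_gset G N \<iota>)) = \<iota> (g, 0)"
  by (simp add: pt_free act_free)

lemma level_ind_iter_Suc:
  assumes I: "I \<subseteq> carrier (free_gset G N \<iota>)" and i: "i \<le> N"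
  shows "level ((ind_op G (free_gset G N \<iota>) ^^ Suc n) I) i =
    level ((ind_op G (free_gset G N \<iota>) ^^ n) I) i \<union>
    {a \<otimes> h |a h. a \<in> level ((ind_op G (free_gset G N \<iota>) ^^ n) I) 0 \<and> h \<in> level ((ind_op G (free_gset G N \<iota>) ^^ n) I) i}"
    (is "level ?I' i = level ?I i \<union> ?S")
proof
  note Suc = ind_iter_Suc[OF I, of n]
  note cl = ind_iter_closed[OF I, of n]
  show "level ?I' i \<subseteq> level ?I i \<union> ?S"
  proof
    fix g assume "g \<in> level ?I' i"
    then have g: "g \<in> carrier G" "\<iota> (g, i) \<in> ?I'"
      by (auto simp: level_def)
    show "g \<in> level ?I i \<union> ?S"
    proof (cases "\<iota> (g, i) \<in> ?I")
      case True
      then show ?thesis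
        using g by (simp add: level_def)
    next
      case False
      then obtain a z where a: "a \<in> carrier G" "z \<in> ?I" "act (free_gset G N \<iota>) a (pt (free_gset G N \<iota>)) \<in> ?I"
          "\<iota> (g, i) = act (free_gset G N \<iota>) a z"
        using g(2) unfolding Suc by blast
      obtain h j where h: "h \<in> carrier G" "j \<le> N" "z = \<iota> (h, j)"
        using a(2) cl by (auto simp: carrier_free)
      then have "g = a \<otimes> h" "j = i"
        using a g i iota_eq_iff[of g "a \<otimes> h" i j] by (auto simp: act_free)
      then show ?thesis
        using a h by (auto simp: level_def act_pt_free)
    qed
  qed
  show "level ?I i \<union> ?S \<subseteq> level ?I' i"
  proof
    fix g assume "g \<in> level ?I i \<union> ?S"
    then show "g \<in> level ?I' i"
    proof
      assume "g \<in> ?S"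
      then obtain a h where a: "g = a \<otimes> h" "a \<in> carrier G" "\<iota> (a, 0) \<in> ?I" "h \<in> carrier G" "\<iota> (h, i) \<in> ?I"
        by (auto simp: level_def)
      have "act (free_gset G N \<iota>) a (pt (free_gset G N \<iota>)) \<in> ?I"
        using a by (simp add: act_pt_free)
      then have "act (free_gset G N \<iota>) a (\<iota> (h, i)) \<in> ?I'"
        unfolding Suc using a by blast
      then show ?thesis
        using a i by (simp add: level_def act_free)
    qed (simp add: level_def Suc del: funpow.simps)
  qed
qed

lemma level_ded_iter_Suc_0:
  assumes I: "I \<subseteq> carrier (free_gset G N \<iota>)"
  shows "level ((ded_op G (free_gset G N \<iota>) ^^ Suc n) I) 0 =
    level ((ded_op G (free_gset G N \<iota>) ^^ n) I) 0 \<union>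
    {a \<otimes> inv h |a h. \<exists>i\<le>N. a \<in> level ((ded_op G (free_gset G N \<iota>) ^^ n) I) i
      \<and> h \<in> level ((ded_op G (free_gset G N \<iota>) ^^ n) I) i}"
    (is "level ?I' 0 = level ?I 0 \<union> ?S")
proof
  note Suc = ded_iter_Suc[OF I, of n]
  note cl = ded_iter_closed[OF I, of n]
  show "level ?I' 0 \<subseteq> level ?I 0 \<union> ?S"
  proof
    fix g assume "g \<in> level ?I' 0"
    then have g: "g \<in> carrier G" "\<iota> (g, 0) \<in> ?I'"
      by (auto simp: level_def)
    show "g \<in> level ?I 0 \<union> ?S"
    proof (cases "\<iota> (g, 0) \<in> ?I")
      case True
      then show ?thesis
        using g by (simp add: level_def)
    next
      case False
      then obtain a z where a: "a \<in> carrier G" "z \<in> ?I" "act (free_gset G N \<iota>) a z \<in> ?I"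
          "\<iota> (g, 0) = act (free_gset G N \<iota>) a (pt (free_gset G N \<iota>))"
        using g(2) unfolding Suc by blast
      obtain h j where h: "h \<in> carrier G" "j \<le> N" "z = \<iota> (h, j)"
        using a(2) cl by (auto simp: carrier_free)
      have "g = a"
        using a g iota_eq_iff[of g a 0 0] by (simp add: act_pt_free)
      then have "g = (g \<otimes> h) \<otimes> inv h" "g \<otimes> h \<in> level ?I j" "h \<in> level ?I j"
        using a h g by (auto simp: level_def act_free m_assoc)
      then show ?thesis
        using h by blast
    qed
  qed
  show "level ?I 0 \<union> ?S \<subseteq> level ?I' 0"
  proof
    fix g assume "g \<in> level ?I 0 \<union> ?S"
    then show "g \<in> level ?I' 0"
    proof
      assume "g \<in> ?S"
      then obtain a h i where a: "g = a \<otimes> inv h" "i \<le> N"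
          "a \<in> carrier G" "\<iota> (a, i) \<in> ?I" "h \<in> carrier G" "\<iota> (h, i) \<in> ?I"
        by (auto simp: level_def)
      have "act (free_gset G N \<iota>) g (\<iota> (h, i)) = \<iota> (a, i)"
        using a by (simp add: act_free m_assoc)
      then have "act (free_gset G N \<iota>) g (pt (free_gset G N \<iota>)) \<in> ?I'"
        unfolding Suc using a
        by (intro UnI2 CollectI exI[of _ g] exI[of _ "\<iota> (h, i)"]) simp
      then show ?thesis
        using a by (simp add: level_def act_pt_free)
    qed (simp add: level_def Suc del: funpow.simps)
  qed
qed

text \<open>
  The deductive operator only adds points of the orbit of the base point.
\<close>

lemma level_ded_iter:
  assumes I: "I \<subseteq> carrier (free_gset G N \<iota>)" and i: "0 < i" "i \<le> N"
  shows "level ((ded_op G (free_gset G N \<iota>) ^^ n) I) i = level I i"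
proof (induction n)
  case (Suc n)
  have "\<iota> (g, i) \<noteq> act (free_gset G N \<iota>) a (pt (free_gset G N \<iota>))" if "g \<in> carrier G" "a \<in> carrier G" for g a
    using that i iota_eq_iff[of g a i 0] by (simp add: act_pt_free)
  then have "level ((ded_op G (free_gset G N \<iota>) ^^ Suc n) I) i = level ((ded_op G (free_gset G N \<iota>) ^^ n) I) i"
    unfolding ded_iter_Suc[OF I] by (auto simp: level_def)
  then show ?case
    using Suc by simp
qed simp

end

lemma (in finite_comm_group) ex_free_pointed_action:
  assumes "infinite (UNIV :: 'x set)"
  shows "\<exists>\<iota> :: 'a \<times> nat \<Rightarrow> 'x. free_pointed_action G N \<iota>"
proof -
  have fin: "finite (carrier G \<times> {..N})"
    using finite_carrier by simp
  obtain B :: "'x set" where "finite B" "card B = card (carrier G \<times> {..N})"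
    using infinite_arbitrarily_large[OF assms] by blast
  then obtain \<iota> where "bij_betw \<iota> (carrier G \<times> {..N}) B"
    using finite_same_card_bij[OF fin] by metis
  then have "free_pointed_action G N \<iota>"
    by unfold_locales (simp add: bij_betw_def)
  then show ?thesis
    by (rule exI[of "free_pointed_action G N"])
qed

section \<open>Coordinates on a sum of cyclic groups\<close>

lemma add_mod_if:
  fixes a b k :: nat
  shows "a < k \<Longrightarrow> b < k \<Longrightarrow> (a + b) mod k = (if a + b < k then a + b else a + b - k)"
  by (simp add: mod_if)

text \<open>
  A decomposition of \<open>G\<close> into cyclic groups, given by residues in \<open>{0..<y i}\<close> with the largest
  factor at index \<open>0\<close>. The empty decomposition (\<open>t = 0\<close>) covers the trivial group.
\<close>

locale coordinates = finite_comm_group G for G (structure) +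
  fixes t :: nat and y :: "nat \<Rightarrow> nat" and crd :: "'a \<Rightarrow> nat \<Rightarrow> nat"
  assumes profile: "profile t y"
    and y_gt_1: "i < t \<Longrightarrow> 1 < y i"
    and crd_less: "g \<in> carrier G \<Longrightarrow> i < t \<Longrightarrow> crd g i < y i"
    and crd_mult: "g \<in> carrier G \<Longrightarrow> h \<in> carrier G \<Longrightarrow> i < t \<Longrightarrow> crd (g \<otimes> h) i = (crd g i + crd h i) mod y i"
    and crd_eqI: "g \<in> carrier G \<Longrightarrow> h \<in> carrier G \<Longrightarrow> (\<And>i. i < t \<Longrightarrow> crd g i = crd h i) \<Longrightarrow> g = h"
    and crd_surj: "(\<And>i. i < t \<Longrightarrow> c i < y i) \<Longrightarrow> \<exists>g\<in>carrier G. \<forall>i<t. crd g i = c i"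
begin

lemma y_pos: "0 < y i"
  using profile by (simp add: profile_def)

lemma crd_one: "i < t \<Longrightarrow> crd \<one> i = 0"
  using crd_mult[of \<one> \<one> i] crd_less[of \<one> i] 
  by (simp add: add_mod_if split: if_splits)

lemma crd_pow: "g \<in> carrier G \<Longrightarrow> i < t \<Longrightarrow> crd (g [^] (n::nat)) i = n * crd g i mod y i"
  by (induction n) (simp_all add: crd_one crd_mult mod_add_right_eq mod_add_left_eq algebra_simps)

text \<open>
  For \<open>i \<ge> t\<close> all coordinates vanish, so \<open>unit i = \<one>\<close>.
\<close>

definition unit :: "nat \<Rightarrow> 'a" where
  "unit i = (SOME g. g \<in> carrier G \<and> (\<forall>j<t. crd g j = (if i = j then 1 else 0)))"

lemma unit: "unit i \<in> carrier G" "j < t \<Longrightarrow> crd (unit i) j = (if i = j then 1 else 0)"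
proof -
  have "\<exists>g\<in>carrier G. \<forall>j<t. crd g j = (if i = j then 1 else 0)"
    using y_gt_1 y_pos by (intro crd_surj) auto
  then have "\<exists>g. g \<in> carrier G \<and> (\<forall>j<t. crd g j = (if i = j then 1 else 0))"
    by blast
  from someI_ex[OF this]
  show "unit i \<in> carrier G" "j < t \<Longrightarrow> crd (unit i) j = (if i = j then 1 else 0)"
    unfolding unit_def by blast+
qed

lemma unit_pow: "unit i [^] y i = \<one>"
  using unit by (intro crd_eqI) (auto simp: crd_pow crd_one)

lemma pow_exponent: "g \<in> carrier G \<Longrightarrow> g [^] y 0 = \<one>"
proof (intro crd_eqI)
  fix i assume "g \<in> carrier G" "i < t"
  moreover have "y i dvd y 0"
    by (rule profile_dvd[OF profile]) simp
  ultimately show "crd (g [^] y 0) i = crd \<one> i"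
    by (simp add: crd_pow crd_one)
qed auto

text \<open>
  In a finite group positive words in the generators suffice: a positive coordinate can be lowered
  without wrapping around, so the coordinate sum decreases.
\<close>

lemma unit_induct:
  assumes "g \<in> carrier G" "P \<one>" and step: "\<And>i h. i < t \<Longrightarrow> h \<in> carrier G \<Longrightarrow> P h \<Longrightarrow> P (unit i \<otimes> h)"
  shows "P g"
  using assms(1)
proof (induction "\<Sum>i<t. crd g i" arbitrary: g rule: less_induct)
  case less
  show ?case
  proof (cases "\<forall>i<t. crd g i = 0")
    case True
    then have "g = \<one>"
      using less by (intro crd_eqI) (auto simp: crd_one)
    then show ?thesis
      using assms(2) by simp
  next
    case False
    then obtain i where i: "i < t" "0 < crd g i"
      by auto
    define h where "h = inv (unit i) \<otimes> g"
    have h: "h \<in> carrier G" "g = unit i \<otimes> h"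
      using less unit by (auto simp: h_def simp flip: m_assoc)
    have eq: "crd g j = ((if i = j then 1 else 0) + crd h j) mod y j" if "j < t" for j
      using h unit that by (auto simp: crd_mult)
    have "Suc (crd h i) \<noteq> y i"
      using eq[of i] i by auto
    then have "crd g i = Suc (crd h i)"
      using eq[of i] i crd_less[OF h(1), of i] by simp
    moreover have "crd g j = crd h j" if "j < t" "j \<noteq> i" for j
      using eq[of j] that crd_less[OF h(1), of j] by auto
    ultimately have "crd h j \<le> crd g j" if "j < t" for j
      using that by (cases "j = i") auto
    then have "(\<Sum>j<t. crd h j) < (\<Sum>j<t. crd g j)"
      using i \<open>crd g i = Suc (crd h i)\<close> by (intro sum_strict_mono_ex1) (auto intro!: bexI[of _ i])
    then show ?thesis
      using less(1) step h i by metis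
  qed
qed

lemma generate_units: "generate G (unit ` {..<t}) = carrier G"
proof
  show "generate G (unit ` {..<t}) \<subseteq> carrier G"
    using unit by (intro generate_incl) auto
  show "carrier G \<subseteq> generate G (unit ` {..<t})"
  proof
    fix g assume "g \<in> carrier G"
    then show "g \<in> generate G (unit ` {..<t})"
      by (rule unit_induct) (auto intro: generate.one generate.eng generate.incl)
  qed
qed

lemma growth_bound_profile: "growth_bound {\<one>} y"
  by (rule growth_bound_trivial[OF profile, of unit]) (simp_all add: unit unit_pow generate_units)

text \<open>
  These are the word lengths with respect to the \<open>unit i\<close>, and to the \<open>unit i\<close> with their inverses.
\<close>

definition pos_length :: "'a \<Rightarrow> nat" where
  "pos_length g = (\<Sum>i<t. crd g i)"

definition sym_length :: "'a \<Rightarrow> nat" where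
  "sym_length g = (\<Sum>i<t. min (crd g i) (y i - crd g i))"

lemma pos_length_one: "pos_length \<one> = 0" and sym_length_one: "sym_length \<one> = 0"
  by (simp_all add: pos_length_def sym_length_def crd_one)

lemma pos_length_unit: "pos_length (unit i) \<le> 1"
  by (simp add: pos_length_def unit)

lemma pos_length_mult:
  "g \<in> carrier G \<Longrightarrow> h \<in> carrier G \<Longrightarrow> pos_length (g \<otimes> h) \<le> pos_length g + pos_length h"
  unfolding pos_length_def sum.distrib[symmetric]
  by (intro sum_mono) (simp add: crd_mult)

lemma crd_inv: "g \<in> carrier G \<Longrightarrow> i < t \<Longrightarrow> crd (inv g) i = (y i - crd g i) mod y i"
proof -
  assume g: "g \<in> carrier G" and i: "i < t"
  have eq: "(crd g i + crd (inv g) i) mod y i = 0"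
    using crd_mult[of g "inv g" i] g i by (simp add: crd_one)
  have less: "crd g i < y i" "crd (inv g) i < y i"
    using g i by (auto intro: crd_less)
  show ?thesis
  proof (cases "crd g i + crd (inv g) i < y i")
    case True
    then show ?thesis
      using eq by simp
  next
    case False
    then have "y i - crd g i = crd (inv g) i"
      using eq less by (simp add: add_mod_if)
    then show ?thesis
      using less by simp
  qed
qed

lemma sym_length_inv: "g \<in> carrier G \<Longrightarrow> sym_length (inv g) = sym_length g"
  unfolding sym_length_def
proof (intro sum.cong refl)
  fix i assume g: "g \<in> carrier G" and "i \<in> {..<t}"
  then have i: "i < t"
    by simp
  show "min (crd (inv g) i) (y i - crd (inv g) i) = min (crd g i) (y i - crd g i)"
    using crd_inv[OF g i] crd_less[OF g i] by (cases "crd g i = 0") (auto simp: min_def)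
qed

lemma sym_length_mult:
  assumes "g \<in> carrier G" "h \<in> carrier G"
  shows "sym_length (g \<otimes> h) \<le> sym_length g + sym_length h"
  unfolding sym_length_def sum.distrib[symmetric]
proof (intro sum_mono)
  fix i assume "i \<in> {..<t}"
  then have i: "i < t"
    by simp
  have "min (n mod k) (k - n mod k) \<le> min a (k - a) + min b (k - b)"
    if "a < k" "b < k" "n = a + b" for a b k n :: nat
  proof (cases "n < k")
    case True
    then show ?thesis
      using that by (auto simp: min_def)
  next
    case False
    then have "n mod k = n - k"
      using that by (simp add: mod_if)
    then show ?thesis
      using that False by (auto simp: min_def)
  qed
  then show "min (crd (g \<otimes> h) i) (y i - crd (g \<otimes> h) i)
    \<le> min (crd g i) (y i - crd g i) + min (crd h i) (y i - crd h i)"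
    using crd_less[OF _ i] crd_mult[OF _ _ i] assms by simp
qed

lemma sym_length_unit: "sym_length (unit i) \<le> 1"
proof -
  have "sym_length (unit i) \<le> pos_length (unit i)"
    unfolding sym_length_def pos_length_def by (intro sum_mono) simp
  then show ?thesis
    using pos_length_unit order_trans by blast
qed

section \<open>Lower bounds\<close>

text \<open>
  Let \<open>I\<close> consist of \<open>T = {1, unit 0, \<dots>}\<close> in the orbit of the base point and of one point in a
  second orbit. Lengths at most double at each step, which gives the bound \<open>2 ^ k\<close> in the orbit of
  the base point and \<open>2 ^ k - 1\<close> in the other one. When the iteration is stationary, the second orbit
  has been filled, including its element of greatest length.
\<close>

theorem ind_stable_lower:
  assumes inf: "infinite (UNIV :: 'x set)"
    and stable: "\<And>A I. A \<in> (pointed_gsets G :: ('x, 'a) pointed_gset set) \<Longrightarrow> I \<subseteq> carrier A \<Longrightarrow> I \<noteq> {} \<Longrightarrow>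
      (ind_op G A ^^ n) I = (ind_op G A ^^ (n + 1)) I"
  shows "(\<Sum>i<t. y i - 1) \<le> 2 ^ n - 1"
proof -
  obtain \<iota> :: "'a \<times> nat \<Rightarrow> 'x" where "free_pointed_action G 1 \<iota>"
    using ex_free_pointed_action[OF inf] by blast
  then interpret F: free_pointed_action G 1 \<iota> .
  define A where "A = free_gset G 1 \<iota>"
  define T where "T = insert \<one> (unit ` {..<t})"
  define I where "I = \<iota> ` (T \<times> {0} \<union> {(\<one>, 1)})"
  define X where "X k i = F.level ((ind_op G A ^^ k) I) i" for k i
  have T: "T \<subseteq> carrier G"
    using unit by (auto simp: T_def)
  have I: "I \<subseteq> carrier (free_gset G 1 \<iota>)" "I \<noteq> {}"
    using T unfolding I_def F.carrier_free by auto
  have X_Suc: "X (Suc k) i = X k i \<union> {a \<otimes> h |a h. a \<in> X k 0 \<and> h \<in> X k i}" if "i \<le> 1" for k i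
    unfolding X_def A_def by (rule F.level_ind_iter_Suc[OF I(1) that])
  have XG: "X k i \<subseteq> carrier G" for k i
    by (auto simp: X_def F.level_def)
  have X0: "X 0 0 = T" "X 0 1 = {\<one>}"
    using T by (auto simp: X_def F.level_def I_def image_iff F.iota_eq_iff subset_eq)
  have len: "(\<forall>g\<in>X k 0. pos_length g \<le> 2 ^ k) \<and> (\<forall>g\<in>X k 1. pos_length g \<le> 2 ^ k - 1)" for k
  proof (induction k)
    case 0
    then show ?case
      using X0 pos_length_unit by (auto simp: T_def pos_length_one)
  next
    case (Suc k)
    have "pos_length (a \<otimes> h) \<le> 2 ^ Suc k" if "a \<in> X k 0" "h \<in> X k 0" for a h
    proof -
      have "pos_length (a \<otimes> h) \<le> pos_length a + pos_length h"
        using that XG by (intro pos_length_mult) auto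
      moreover have "pos_length a \<le> 2 ^ k" "pos_length h \<le> 2 ^ k"
        using Suc that by auto
      ultimately show ?thesis
        unfolding power_Suc by linarith
    qed
    moreover have "pos_length (a \<otimes> h) \<le> 2 ^ Suc k - 1" if "a \<in> X k 0" "h \<in> X k 1" for a h
    proof -
      have "pos_length (a \<otimes> h) \<le> pos_length a + pos_length h"
        using that XG by (intro pos_length_mult) auto
      moreover have "pos_length a \<le> 2 ^ k" "pos_length h \<le> 2 ^ k - 1"
        using Suc that by auto
      moreover have "(1::nat) \<le> 2 ^ k"
        by simp
      ultimately show ?thesis
        unfolding power_Suc by linarith
    qed
    moreover have "pos_length g \<le> 2 ^ Suc k" if "g \<in> X k 0" for g
      using Suc that by fastforce
    moreover have "pos_length g \<le> 2 ^ Suc k - 1" if "g \<in> X k 1" for g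
      using Suc that by fastforce
    ultimately show ?case
      by (auto simp: X_Suc)
  qed
  have "X 0 i \<subseteq> X k i" if "i \<le> 1" for k i
    using that by (induction k) (auto simp: X_Suc)
  then have mono: "T \<subseteq> X n 0" "\<one> \<in> X n 1"
    using X0 by fastforce+
  have stab: "X (Suc n) 1 = X n 1"
    unfolding X_def A_def using stable[OF F.free_gset_in I] by simp
  have all: "g \<in> X n 1" if "g \<in> carrier G" for g
    using that
  proof (rule unit_induct)
    fix i h assume "i < t" "h \<in> X n 1"
    then have "unit i \<otimes> h \<in> X (Suc n) 1"
      using mono by (auto simp: X_Suc T_def)
    then show "unit i \<otimes> h \<in> X n 1"
      using stab by simp
  qed (rule mono)
  obtain g where g: "g \<in> carrier G" "\<forall>i<t. crd g i = y i - 1"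
    using crd_surj[of "\<lambda>i. y i - 1"] y_pos by auto
  have "(\<Sum>i<t. y i - 1) = pos_length g"
    using g by (simp add: pos_length_def)
  also have "\<dots> \<le> 2 ^ n - 1"
    using len all[OF g(1)] by blast
  finally show ?thesis .
qed

text \<open>
  Let \<open>I\<close> consist of \<open>t + 1\<close> sets \<open>{\<one>, unit i}\<close>, one in each of the orbits \<open>1, \<dots>, t + 1\<close>; the last
  of them is a single point, which keeps \<open>I\<close> non-empty for \<open>t = 0\<close>. The orbit of the base point
  does not meet \<open>I\<close> and changes at the first step, so \<open>n > 0\<close>. From then on the symmetric length at
  most doubles at each step, and a stationary set is a subgroup containing all units.
\<close>

theorem ded_stable_lower:
  assumes inf: "infinite (UNIV :: 'x set)"
    and stable: "\<And>A I. A \<in> (pointed_gsets G :: ('x, 'a) pointed_gset set) \<Longrightarrow> I \<subseteq> carrier A \<Longrightarrow> I \<noteq> {} \<Longrightarrow>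
      (ded_op G A ^^ n) I = (ded_op G A ^^ (n + 1)) I"
  shows "0 < n" "(\<Sum>i<t. y i div 2) \<le> 2 ^ (n - 1)"
proof -
  obtain \<iota> :: "'a \<times> nat \<Rightarrow> 'x" where "free_pointed_action G (Suc t) \<iota>"
    using ex_free_pointed_action[OF inf] by blast
  then interpret F: free_pointed_action G "Suc t" \<iota> .
  define A where "A = free_gset G (Suc t) \<iota>"
  define I where "I = {\<iota> (g, Suc i) |g i. i \<le> t \<and> g \<in> {\<one>, unit i}}"
  define X where "X k i = F.level ((ded_op G A ^^ k) I) i" for k i
  have I: "I \<subseteq> carrier (free_gset G (Suc t) \<iota>)" "I \<noteq> {}"
    using unit by (auto simp: I_def F.carrier_free)
  have X_Suc: "X (Suc k) 0 = X k 0 \<union> {a \<otimes> inv h |a h. \<exists>i\<le>Suc t. a \<in> X k i \<and> h \<in> X k i}" for k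
    unfolding X_def A_def by (rule F.level_ded_iter_Suc_0[OF I(1)])
  have XG: "X k i \<subseteq> carrier G" for k i
    by (auto simp: X_def F.level_def)
  have X0: "X 0 0 = {}"
    using unit by (auto simp: X_def F.level_def I_def F.iota_eq_iff)
  have X1: "X k (Suc i) = {\<one>, unit i}" if "i \<le> t" for k i
  proof -
    have "X k (Suc i) = F.level I (Suc i)"
      unfolding X_def A_def using that by (intro F.level_ded_iter[OF I(1)]) auto
    also have "\<dots> = {\<one>, unit i}"
      using unit that by (auto simp: F.level_def I_def F.iota_eq_iff)
    finally show ?thesis .
  qed
  have short: "sym_length (a \<otimes> inv h) \<le> 1" if "a \<in> {\<one>, unit i}" "h \<in> {\<one>, unit i}" for a h i
    using that unit sym_length_unit[of i] by (auto simp: sym_length_one sym_length_inv)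
  have len: "\<forall>g\<in>X (Suc k) 0. sym_length g \<le> 2 ^ k" for k
  proof (induction k)
    case 0
    have "sym_length (a \<otimes> inv h) \<le> 1" if "i \<le> Suc t" "a \<in> X 0 i" "h \<in> X 0 i" for a h i
      using that short X0 X1 by (cases i) auto
    then show ?case
      unfolding X_Suc[of 0] X0 by auto
  next
    case (Suc k)
    note len = this
    have "sym_length (a \<otimes> inv h) \<le> 2 ^ Suc k" if "i \<le> Suc t" "a \<in> X (Suc k) i" "h \<in> X (Suc k) i" for a h i
    proof (cases i)
      case 0
      have c: "a \<in> carrier G" "h \<in> carrier G"
        using that XG by blast+
      then have "sym_length (a \<otimes> inv h) \<le> sym_length a + sym_length h"
        using sym_length_mult[of a "inv h"] by (simp add: sym_length_inv)
      moreover have "sym_length a \<le> 2 ^ k" "sym_length h \<le> 2 ^ k"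
        using len that 0 by auto
      ultimately show ?thesis
        unfolding power_Suc by linarith
    next
      case (Suc j)
      then have "sym_length (a \<otimes> inv h) \<le> 1"
        using that X1 by (intro short[of _ j]) auto
      also have "1 \<le> (2::nat) ^ Suc k"
        by (rule one_le_power) simp
      finally show ?thesis .
    qed
    moreover have "sym_length g \<le> 2 ^ Suc k" if "g \<in> X (Suc k) 0" for g
      using len that by fastforce
    ultimately show ?case
      unfolding X_Suc[of "Suc k"] by blast
  qed
  have units: "\<one> \<in> X (Suc k) 0 \<and> (\<forall>i<t. unit i \<in> X (Suc k) 0)" for k
  proof (induction k)
    case 0
    have "unit i \<in> X (Suc 0) 0" if "i \<le> t" for i
    proof -
      have "unit i = unit i \<otimes> inv \<one>" "Suc i \<le> Suc t" "unit i \<in> X 0 (Suc i)" "\<one> \<in> X 0 (Suc i)"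
        using that unit X1 by auto
      then show ?thesis
        unfolding X_Suc by blast
    qed
    moreover have "\<one> = \<one> \<otimes> inv \<one>" "\<one> \<in> X 0 (Suc 0)"
      using X1 by auto
    then have "\<one> \<in> X (Suc 0) 0"
      unfolding X_Suc by fastforce
    ultimately show ?case
      by auto
  next
    case (Suc k)
    then show ?case
      unfolding X_Suc[of "Suc k"] by blast
  qed
  have stab: "X (Suc n) 0 = X n 0"
    unfolding X_def A_def using stable[OF F.free_gset_in I] by simp
  show n: "0 < n"
    using stab units[of 0] X0 by (cases n) auto
  then obtain k where k: "n = Suc k"
    by (cases n) auto
  have closed: "a \<otimes> inv h \<in> X n 0" if "a \<in> X n 0" "h \<in> X n 0" for a h
    using that stab unfolding X_Suc by blast
  have all: "g \<in> X n 0" if "g \<in> carrier G" for g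
    using that
  proof (rule unit_induct)
    show one: "\<one> \<in> X n 0"
      using units k by simp
    fix i h assume h: "i < t" "h \<in> carrier G" "h \<in> X n 0"
    then have "unit i \<otimes> inv (\<one> \<otimes> inv h) \<in> X n 0"
      using one units k by (intro closed) auto
    then show "unit i \<otimes> h \<in> X n 0"
      using h by simp
  qed
  obtain g where g: "g \<in> carrier G" "\<forall>i<t. crd g i = y i div 2"
    using crd_surj[of "\<lambda>i. y i div 2"] y_pos by auto
  have "min (n div 2) (n - n div 2) = n div 2" for n :: nat
    by linarith
  then have "(\<Sum>i<t. y i div 2) = sym_length g"
    using g by (simp add: sym_length_def)
  also have "\<dots> \<le> 2 ^ (n - 1)"
    using len all[OF g(1)] k by simp
  finally show "(\<Sum>i<t. y i div 2) \<le> 2 ^ (n - 1)" .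
qed

text \<open>
  Start from the single point \<open>a c\<close>, where \<open>a\<close> has the largest order \<open>y 0\<close>. A stationary set
  contains all powers of \<open>a\<close>, but after \<open>n\<close> steps the exponents reached lie in an interval with
  \<open>2 ^ (n - 1) + 1\<close> elements. The interval is \<open>{0, 1}\<close> at the first step, and the quotients of powers
  from an interval of length \<open>l\<close> have exponents between \<open>-l\<close> and \<open>l\<close>.
\<close>

theorem ded_stable_lower_exponent:
  assumes inf: "infinite (UNIV :: 'x set)"
    and stable: "\<And>A I. A \<in> (pointed_gsets G :: ('x, 'a) pointed_gset set) \<Longrightarrow> I \<subseteq> carrier A \<Longrightarrow> I \<noteq> {} \<Longrightarrow>
      (ded_op G A ^^ n) I = (ded_op G A ^^ (n + 1)) I"
    and n: "0 < n"
  shows "y 0 - 1 \<le> 2 ^ (n - 1)"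
proof (cases "t = 0")
  case True
  then show ?thesis
    using profile by (simp add: profile_def)
next
  case False
  obtain \<iota> :: "'a \<times> nat \<Rightarrow> 'x" where "free_pointed_action G 0 \<iota>"
    using ex_free_pointed_action[OF inf] by blast
  then interpret F: free_pointed_action G 0 \<iota> .
  define A where "A = free_gset G 0 \<iota>"
  define a where "a = unit 0"
  define I where "I = {\<iota> (a, 0)}"
  define X where "X k = F.level ((ded_op G A ^^ k) I) 0" for k
  have a: "a \<in> carrier G"
    using unit by (simp add: a_def)
  have I: "I \<subseteq> carrier (free_gset G 0 \<iota>)" "I \<noteq> {}"
    using a by (auto simp: I_def F.carrier_free)
  have X_Suc: "X (Suc k) = X k \<union> {u \<otimes> inv v |u v. u \<in> X k \<and> v \<in> X k}" for k
    unfolding X_def A_def using F.level_ded_iter_Suc_0[OF I(1)] by simp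
  have X0: "X 0 = {a}"
    using a by (auto simp: X_def F.level_def I_def F.iota_eq_iff)
  have X1: "\<one> \<in> X (Suc k) \<and> a \<in> X (Suc k)" for k
    using a by (induction k) (auto simp: X_Suc X0)
  have window: "\<exists>lo::int. X (Suc k) \<subseteq> (\<lambda>i. a [^] i) ` {lo..lo + 2 ^ k}" for k
  proof (induction k)
    case 0
    have "X (Suc 0) \<subseteq> {\<one>, a}"
      using a by (auto simp: X_Suc X0)
    also have "\<dots> \<subseteq> (\<lambda>i::int. a [^] i) ` {0..0 + 2 ^ 0}"
      using a by (auto simp: image_iff intro: bexI[of _ 0] bexI[of _ 1])
    finally show ?case
      by blast
  next
    case (Suc k)
    then obtain lo :: int where lo: "X (Suc k) \<subseteq> (\<lambda>i. a [^] i) ` {lo..lo + 2 ^ k}"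
      by blast
    have quot: "u \<otimes> inv v \<in> (\<lambda>i::int. a [^] i) ` {- (2 ^ k)..- (2 ^ k) + 2 ^ Suc k}"
      if uv: "u \<in> X (Suc k)" "v \<in> X (Suc k)" for u v
    proof -
      obtain i j where ij: "u = a [^] i" "i \<in> {lo..lo + 2 ^ k}" "v = a [^] j" "j \<in> {lo..lo + 2 ^ k}"
        by (rule imageE[OF subsetD[OF lo uv(1)]], rule imageE[OF subsetD[OF lo uv(2)]]) blast
      then have "u \<otimes> inv v = a [^] (i - j)"
        using a by (simp add: int_pow_diff)
      then show ?thesis
        using ij by (intro image_eqI[of _ _ "i - j"]) auto
    qed
    have "u = u \<otimes> inv \<one>" if "u \<in> X (Suc k)" for u
      using that by (auto simp: X_def F.level_def)
    then have "X (Suc (Suc k)) \<subseteq> (\<lambda>i::int. a [^] i) ` {- (2 ^ k)..- (2 ^ k) + 2 ^ Suc k}"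
      unfolding X_Suc[of "Suc k"] using quot X1[of k] by fastforce
    then show ?case
      by blast
  qed
  obtain k where k: "n = Suc k"
    using n by (cases n) auto
  have stab: "X (Suc n) = X n"
    unfolding X_def A_def using stable[OF F.free_gset_in I] by simp
  have closed: "u \<otimes> inv v \<in> X n" if "u \<in> X n" "v \<in> X n" for u v
    using that stab unfolding X_Suc by blast
  have pow: "a [^] (i::nat) \<in> X n" for i
  proof (induction i)
    case 0
    then show ?case
      using X1 k by simp
  next
    case (Suc i)
    have "a [^] i \<otimes> inv (\<one> \<otimes> inv a) \<in> X n"
      using Suc X1 k by (intro closed) auto
    then show ?case
      using a by simp
  qed
  have "inj_on (\<lambda>i::nat. a [^] i) {..<y 0}"
  proof (rule inj_onI)
    fix i j assume "i \<in> {..<y 0}" "j \<in> {..<y 0}" "a [^] i = a [^] j"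
    then show "i = j"
      using crd_pow[OF a, of 0 i] crd_pow[OF a, of 0 j] False unit(2)[of 0 0] by (simp add: a_def)
  qed
  then have "y 0 = card ((\<lambda>i::nat. a [^] i) ` {..<y 0})"
    by (simp add: card_image)
  also have "\<dots> \<le> card (X n)"
    using pow finite_carrier by (intro card_mono) (auto simp: X_def F.level_def)
  also have "\<dots> \<le> 2 ^ k + 1"
  proof -
    obtain lo :: int where lo: "X (Suc k) \<subseteq> (\<lambda>i. a [^] i) ` {lo..lo + 2 ^ k}"
      using window by blast
    have "card (X n) \<le> card ((\<lambda>i. a [^] i) ` {lo..lo + 2 ^ k})"
      using lo k by (intro card_mono) auto
    also have "\<dots> \<le> card {lo..lo + 2 ^ k}"
      by (rule card_image_le) simp
    also have "\<dots> = 2 ^ k + 1"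
      by (simp add: nat_add_distrib nat_power_eq)
    finally show ?thesis .
  qed
  finally show ?thesis
    using k by simp
qed

end

section \<open>The two ranks\<close>

lemma Inf_enat_upward_closed:
  assumes "\<And>n. Q n \<longleftrightarrow> N \<le> n"
  shows "Inf {enat n |n. Q n} = enat N"
  using assms by (intro antisym Inf_lower Inf_greatest) auto

lemma nat_ceiling_log2_le_iff:
  assumes "1 \<le> X"
  shows "nat \<lceil>log 2 (real X)\<rceil> \<le> n \<longleftrightarrow> X \<le> 2 ^ n"
proof -
  have "nat \<lceil>log 2 (real X)\<rceil> \<le> n \<longleftrightarrow> log 2 (real X) \<le> real n"
    by (simp add: nat_le_iff ceiling_le_iff)
  also have "\<dots> \<longleftrightarrow> real X \<le> 2 powr real n"
    using assms by (simp add: log_le_iff)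
  also have "\<dots> \<longleftrightarrow> real X \<le> real (2 ^ n)"
    by (simp add: powr_realpow)
  finally show ?thesis
    by (simp only: of_nat_le_iff)
qed

context coordinates
begin

theorem inductive_rank_eq:
  assumes "infinite (UNIV :: 'x set)"
  shows "inductive_rank TYPE('x) G = enat (nat \<lceil>log 2 (real ((\<Sum>i<t. y i - 1) + 1))\<rceil>)"
  unfolding inductive_rank_def
proof (rule Inf_enat_upward_closed)
  fix n
  have "nat \<lceil>log 2 (real ((\<Sum>i<t. y i - 1) + 1))\<rceil> \<le> n \<longleftrightarrow> (\<Sum>i<t. y i - 1) + 1 \<le> 2 ^ n"
    by (rule nat_ceiling_log2_le_iff) simp
  also have "\<dots> \<longleftrightarrow> (\<Sum>i<t. y i - 1) \<le> 2 ^ n - 1"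
    using one_le_power[of "2::nat" n] by linarith
  finally have *: "nat \<lceil>log 2 (real ((\<Sum>i<t. y i - 1) + 1))\<rceil> \<le> n \<longleftrightarrow> (\<Sum>i<t. y i - 1) \<le> 2 ^ n - 1" .
  show "(\<forall>A\<in>(pointed_gsets G :: ('x, 'a) pointed_gset set). \<forall>I. I \<subseteq> carrier A \<and> I \<noteq> {} \<longrightarrow>
      (ind_op G A ^^ n) I = (ind_op G A ^^ (n + 1)) I)
    \<longleftrightarrow> nat \<lceil>log 2 (real ((\<Sum>i<t. y i - 1) + 1))\<rceil> \<le> n" (is "?stable \<longleftrightarrow> _")
    unfolding *
  proof
    assume ?stable
    then show "(\<Sum>i<t. y i - 1) \<le> 2 ^ n - 1"
      by (intro ind_stable_lower[OF assms]) blast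
  next
    assume le: "(\<Sum>i<t. y i - 1) \<le> 2 ^ n - 1"
    show ?stable
    proof (intro ballI allI impI)
      fix A :: "('x, 'a) pointed_gset" and I
      assume "A \<in> pointed_gsets G" and I: "I \<subseteq> carrier A \<and> I \<noteq> {}"
      then interpret pointed_action G A
        by unfold_locales
      show "(ind_op G A ^^ n) I = (ind_op G A ^^ (n + 1)) I"
        using ind_iter_stable[OF growth_bound_profile profile le] I by blast
    qed
  qed
qed

text \<open>
  The outer maximum with \<open>1\<close> matters only for the trivial group, where the other two numbers vanish.
\<close>

theorem deductive_rank_eq:
  assumes "infinite (UNIV :: 'x set)"
  shows "deductive_rank TYPE('x) G =
    1 + enat (nat \<lceil>log 2 (real (max 1 (max (y 0 - 1) (\<Sum>i<t. y i div 2))))\<rceil>)"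
proof -
  define X where "X = max 1 (max (y 0 - 1) (\<Sum>i<t. y i div 2))"
  have "deductive_rank TYPE('x) G = enat (Suc (nat \<lceil>log 2 (real X)\<rceil>))"
    unfolding deductive_rank_def
  proof (rule Inf_enat_upward_closed)
    fix n
    have *: "Suc (nat \<lceil>log 2 (real X)\<rceil>) \<le> n \<longleftrightarrow>
      0 < n \<and> (\<Sum>i<t. y i div 2) \<le> 2 ^ (n - 1) \<and> y 0 - 1 \<le> 2 ^ (n - 1)"
    proof (cases n)
      case (Suc k)
      have "Suc (nat \<lceil>log 2 (real X)\<rceil>) \<le> n \<longleftrightarrow> X \<le> 2 ^ k"
        using nat_ceiling_log2_le_iff[of X k] by (simp add: Suc X_def)
      then show ?thesis
        using one_le_power[of "2::nat" k] by (auto simp: Suc X_def)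
    qed simp
    show "(\<forall>A\<in>(pointed_gsets G :: ('x, 'a) pointed_gset set). \<forall>I. I \<subseteq> carrier A \<and> I \<noteq> {} \<longrightarrow>
        (ded_op G A ^^ n) I = (ded_op G A ^^ (n + 1)) I)
      \<longleftrightarrow> Suc (nat \<lceil>log 2 (real X)\<rceil>) \<le> n" (is "?stable \<longleftrightarrow> _")
      unfolding *
    proof
      assume ?stable
      then have stable: "\<And>A I. A \<in> (pointed_gsets G :: ('x, 'a) pointed_gset set) \<Longrightarrow> I \<subseteq> carrier A \<Longrightarrow> I \<noteq> {} \<Longrightarrow>
          (ded_op G A ^^ n) I = (ded_op G A ^^ (n + 1)) I"
        by blast
      show "0 < n \<and> (\<Sum>i<t. y i div 2) \<le> 2 ^ (n - 1) \<and> y 0 - 1 \<le> 2 ^ (n - 1)"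
        using ded_stable_lower[OF assms stable] ded_stable_lower_exponent[OF assms stable] by blast
    next
      assume le: "0 < n \<and> (\<Sum>i<t. y i div 2) \<le> 2 ^ (n - 1) \<and> y 0 - 1 \<le> 2 ^ (n - 1)"
      show ?stable
      proof (intro ballI allI impI)
        fix A :: "('x, 'a) pointed_gset" and I
        assume "A \<in> pointed_gsets G" and I: "I \<subseteq> carrier A \<and> I \<noteq> {}"
        then interpret pointed_action G A
          by unfold_locales
        show "(ded_op G A ^^ n) I = (ded_op G A ^^ (n + 1)) I"
          using ded_iter_stable[OF growth_bound_profile profile pow_exponent] le I by blast
      qed
    qed
  qed
  then show ?thesis
    by (simp add: X_def one_enat_def)
qed

end

lemma coordinates_trivial:
  assumes "comm_group G" "trivial_group G"
  shows "coordinates G 0 (\<lambda>_. 1) (\<lambda>_ _. 0)"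
proof -
  interpret comm_group G by fact
  show ?thesis
    using assms(2) by unfold_locales (auto simp: trivial_group_def profile_def)
qed

text \<open>
  Indices are reversed, since the invariant factors \<open>m 1, \<dots>, m t\<close> are given in increasing order.
\<close>

lemma coordinates_of_invariant_factors:
  fixes m :: "nat \<Rightarrow> nat"
  assumes G: "comm_group G" "finite (carrier G)"
    and m: "\<And>i. i \<in> {1..t} \<Longrightarrow> 1 < m i" "\<And>i. 1 \<le> i \<Longrightarrow> i < t \<Longrightarrow> m i dvd m (i + 1)"
    and iso: "\<phi> \<in> iso G (sum_group {1..t} (\<lambda>i. integer_mod_group (m i)))"
  shows "coordinates G t (\<lambda>i. if i < t then m (t - i) else 1) (\<lambda>g i. nat (\<phi> g (t - i)))"
proof -
  interpret comm_group G by fact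
  have car: "carrier (sum_group {1..t} (\<lambda>i. integer_mod_group (m i))) = (\<Pi>\<^sub>E i\<in>{1..t}. {0..<int (m i)})"
  proof -
    have "(\<Pi>\<^sub>E i\<in>{1..t}. carrier (integer_mod_group (m i))) = (\<Pi>\<^sub>E i\<in>{1..t}. {0..<int (m i)})"
      using m(1) by (intro PiE_cong) (force simp: carrier_integer_mod_group)
    then show ?thesis
      by (simp add: carrier_sum_group)
  qed
  have bij: "bij_betw \<phi> (carrier G) (\<Pi>\<^sub>E i\<in>{1..t}. {0..<int (m i)})"
    using iso unfolding iso_def car by simp
  have range: "0 \<le> \<phi> g j \<and> \<phi> g j < int (m j)" if "g \<in> carrier G" "j \<in> {1..t}" for g j
    using bij_betwE[OF bij] that by (fastforce simp: PiE_iff)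
  have idx: "t - i \<in> {1..t}" if "i < t" for i
    using that by auto
  show ?thesis
  proof unfold_locales
    have "m (t - Suc i) dvd m (t - i)" if "Suc i < t" for i
      using m(2)[of "t - Suc i"] that by (simp add: Suc_diff_Suc)
    moreover have "0 < m (t - i)" if "i < t" for i
      using m(1)[OF idx[OF that]] by simp
    ultimately show "profile t (\<lambda>i. if i < t then m (t - i) else 1)"
      by (auto simp: profile_def)
    show "1 < (if i < t then m (t - i) else 1)" if "i < t" for i
      using that m(1)[OF idx] by simp
    show "nat (\<phi> g (t - i)) < (if i < t then m (t - i) else 1)" if "g \<in> carrier G" "i < t" for g i
      using range[OF that(1) idx[OF that(2)]] that by (simp add: nat_less_iff)
    show "nat (\<phi> (g \<otimes>\<^bsub>G\<^esub> h) (t - i)) = (nat (\<phi> g (t - i)) + nat (\<phi> h (t - i))) mod (if i < t then m (t - i) else 1)"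
      if "g \<in> carrier G" "h \<in> carrier G" "i < t" for g h i
    proof -
      have "\<phi> (g \<otimes>\<^bsub>G\<^esub> h) = \<phi> g \<otimes>\<^bsub>sum_group {1..t} (\<lambda>i. integer_mod_group (m i))\<^esub> \<phi> h"
        using iso that by (simp add: iso_def hom_def)
      then have "\<phi> (g \<otimes>\<^bsub>G\<^esub> h) (t - i) = (\<phi> g (t - i) + \<phi> h (t - i)) mod int (m (t - i))"
        using idx[OF that(3)] by simp
      then show ?thesis
        using range[OF that(1) idx[OF that(3)]] range[OF that(2) idx[OF that(3)]] that
        by (simp add: nat_mod_distrib nat_add_distrib)
    qed
    show "g = h" if g: "g \<in> carrier G" "h \<in> carrier G"
      and eq: "\<And>i. i < t \<Longrightarrow> nat (\<phi> g (t - i)) = nat (\<phi> h (t - i))" for g h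
    proof -
      have "\<phi> g j = \<phi> h j" if "j \<in> {1..t}" for j
        using eq[of "t - j"] that range[OF g(1) that] range[OF g(2) that] by (simp add: eq_nat_nat_iff)
      moreover have "\<phi> g \<in> (\<Pi>\<^sub>E i\<in>{1..t}. {0..<int (m i)})" "\<phi> h \<in> (\<Pi>\<^sub>E i\<in>{1..t}. {0..<int (m i)})"
        using bij_betwE[OF bij] g by auto
      ultimately have "\<phi> g = \<phi> h"
        using PiE_ext[of "\<phi> g" "{1..t}" "\<lambda>i. {0..<int (m i)}" "\<phi> h"] by blast
      then show ?thesis
        using bij g by (auto simp: bij_betw_def dest: inj_onD)
    qed
    show "\<exists>g\<in>carrier G. \<forall>i<t. nat (\<phi> g (t - i)) = c i"
      if c: "\<And>i. i < t \<Longrightarrow> c i < (if i < t then m (t - i) else 1)" for c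
    proof -
      define x where "x = (\<lambda>j\<in>{1..t}. int (c (t - j)))"
      have "x \<in> (\<Pi>\<^sub>E i\<in>{1..t}. {0..<int (m i)})"
      proof (rule PiE_I)
        fix j assume "j \<in> {1..t}"
        then show "x j \<in> {0..<int (m j)}"
          using c[of "t - j"] by (simp add: x_def)
      qed (auto simp: x_def)
      then obtain g where "g \<in> carrier G" "\<phi> g = x"
        using bij by (metis bij_betw_imp_surj_on imageE)
      then show ?thesis
        using idx by (intro bexI[of _ g]) (auto simp: x_def)
    qed
  qed (use G in auto)
qed

theorem theorem4p7:
  fixes G :: "('g, 'b) monoid_scheme"
  assumes "infinite (UNIV :: 'a set)"
    and "comm_group G" and "finite (carrier G)"
  shows
    "(\<not> trivial_group G \<longrightarrow>
       (\<forall>(t :: nat) (m :: nat \<Rightarrow> nat).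
          (\<forall>i\<in>{1..t}. 1 < m i) \<and> (\<forall>i. 1 \<le> i \<and> i < t \<longrightarrow> m i dvd m (i + 1)) \<and>
          G \<cong> sum_group {1..t} (\<lambda>i. integer_mod_group (m i)) \<longrightarrow>
          (let P = (\<Sum>i = 1..t. (m i - 1));
               Q = (\<Sum>i = 1..t. (m i div 2));
               e = m t
           in (inductive_rank TYPE('a) G, deductive_rank TYPE('a) G) =
                (enat (nat \<lceil>log 2 (real (P + 1))\<rceil>),
                 1 + enat (nat \<lceil>log 2 (real (max (e - 1) Q))\<rceil>))))) \<and>
     (trivial_group G \<longrightarrow>
       (inductive_rank TYPE('a) G, deductive_rank TYPE('a) G) = (0, 1))"
proof (intro conjI impI allI)
  fix t :: nat and m :: "nat \<Rightarrow> nat"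
  assume nontrivial: "\<not> trivial_group G"
    and m: "(\<forall>i\<in>{1..t}. 1 < m i) \<and> (\<forall>i. 1 \<le> i \<and> i < t \<longrightarrow> m i dvd m (i + 1)) \<and>
      G \<cong> sum_group {1..t} (\<lambda>i. integer_mod_group (m i))"
  then obtain \<phi> where \<phi>: "\<phi> \<in> iso G (sum_group {1..t} (\<lambda>i. integer_mod_group (m i)))"
    by (auto simp: is_iso_def)
  define y where "y i = (if i < t then m (t - i) else 1)" for i
  interpret coordinates G t y "\<lambda>g i. nat (\<phi> g (t - i))"
    unfolding y_def using coordinates_of_invariant_factors[OF assms(2,3) _ _ \<phi>] m by blast
  have t: "0 < t"
  proof (rule ccontr)
    assume "\<not> 0 < t"
    then have "g = \<one>\<^bsub>G\<^esub>" if "g \<in> carrier G" for g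
      using that by (intro crd_eqI) auto
    then show False
      using nontrivial unfolding trivial_group_subset by blast
  qed
  have sums: "(\<Sum>i<t. f (y i)) = (\<Sum>i = 1..t. f (m i))" for f :: "nat \<Rightarrow> nat"
    by (rule sum.reindex_bij_witness[of _ "\<lambda>i. t - i" "\<lambda>i. t - i"]) (auto simp: y_def)
  have y0: "y 0 = m t" "1 \<le> m t - 1"
    using t m by (auto simp: y_def Suc_le_eq)
  then have "max 1 (max (y 0 - 1) Q) = max (m t - 1) Q" for Q
    by linarith
  then show "let P = (\<Sum>i = 1..t. (m i - 1)); Q = (\<Sum>i = 1..t. (m i div 2)); e = m t
      in (inductive_rank TYPE('a) G, deductive_rank TYPE('a) G) =
        (enat (nat \<lceil>log 2 (real (P + 1))\<rceil>), 1 + enat (nat \<lceil>log 2 (real (max (e - 1) Q))\<rceil>))"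
    unfolding Let_def inductive_rank_eq[OF assms(1)] deductive_rank_eq[OF assms(1)]
      sums[of "\<lambda>n. n - 1"] sums[of "\<lambda>n. n div 2"] by (simp only:)
next
  assume "trivial_group G"
  then interpret coordinates G 0 "\<lambda>_. 1" "\<lambda>_ _. 0"
    by (rule coordinates_trivial[OF assms(2)])
  show "(inductive_rank TYPE('a) G, deductive_rank TYPE('a) G) = (0, 1)"
    using inductive_rank_eq[OF assms(1)] deductive_rank_eq[OF assms(1)]
    by (simp add: zero_enat_def one_enat_def)
qed

end
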